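(* Let $H$ be an infinite dimensional complex Hilbert space and let $T \in \mathcal{B}(H)$ be a positive operator. Then $T \in \overline{\mathcal{AN}(H)}_{+}$ if and only if the essential spectrum $\sigma_{ess}(T)$ is a singleton set.
   Context: $\mathcal{B}(H)$ is the space of bounded linear operators on $H$ with the operator norm, and $\mathcal{K}(H)$ is the ideal of compact operators. $T\in\mathcal{B}(H)$ is norm attaining if there is $x\in H$ with $\|x\|=1$ and $\|Tx\|=\|T\|$ (similarly for operators between two Hilbert spaces). $T$ is absolutely norm attaining (an $\mathcal{AN}$-operator) if for every nonzero closed subspace $M$ of $H$ the restriction $T|_M:M\to H$ is norm attaining. $\mathcal{AN}(H)$ is the set of $\mathcal{AN}$-operators on $H$, $\overline{\mathcal{AN}(H)}$ is its closure in the operator norm, and $\overline{\mathcal{AN}(H)}_+$ is the set of positive operators in $\overline{\mathcal{AN}(H)}$. Positive means self-adjoint with $\langle Tx,x\rangle\ge 0$ for all $x$. The essential spectrum is $\sigma_{ess}(T)=\sigma(\pi(T))$, where $\pi:\mathcal{B}(H)\to\mathcal{B}(H)/\mathcal{K}(H)$ is the quotient map. *)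

theory Defs
  imports "HOL-Analysis.Analysis" "HOL-Algebra.QuotRing"
begin

section \<open>Complex Hilbert spaces\<close>

class complex_vector = real_vector +
  fixes scaleC :: "complex \<Rightarrow> 'a \<Rightarrow> 'a"  (infixr \<open>*\<^sub>C\<close> 75)
  assumes scaleC_add_right: "c *\<^sub>C (x + y) = c *\<^sub>C x + c *\<^sub>C y"
    and scaleC_add_left: "(c + d) *\<^sub>C x = c *\<^sub>C x + d *\<^sub>C x"
    and scaleC_scaleC: "c *\<^sub>C (d *\<^sub>C x) = (c * d) *\<^sub>C x"
    and scaleC_one: "1 *\<^sub>C x = x"
    and scaleR_scaleC: "r *\<^sub>R x = complex_of_real r *\<^sub>C x"

text \<open>The inner product is linear in the first and conjugate-linear in the second argument.\<close>

class complex_inner = complex_vector + real_normed_vector +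
  fixes cinner :: "'a \<Rightarrow> 'a \<Rightarrow> complex"
  assumes cinner_commute: "cinner x y = cnj (cinner y x)"
    and cinner_add_left: "cinner (x + y) z = cinner x z + cinner y z"
    and cinner_scaleC_left: "cinner (c *\<^sub>C x) y = c * cinner x y"
    and cinner_ge_zero: "0 \<le> Re (cinner x x)"
    and cinner_eq_zero_iff: "cinner x x = 0 \<longleftrightarrow> x = 0"
    and norm_eq_sqrt_cinner: "norm x = sqrt (Re (cinner x x))"

class chilbert_space = complex_inner + complete_space

instantiation complex :: chilbert_space
begin
definition "scaleC_complex (c :: complex) (x :: complex) = c * x"
definition "cinner_complex (x :: complex) (y :: complex) = x * cnj y"
instance
proof
  fix x :: complex
  show "norm x = sqrt (Re (cinner x x))"
    by (simp add: cinner_complex_def cmod_def power2_eq_square)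
qed (auto simp: scaleC_complex_def cinner_complex_def algebra_simps scaleR_conv_of_real)
end

global_interpretation complex_vector: vector_space "scaleC :: complex \<Rightarrow> 'a \<Rightarrow> 'a::complex_vector"
  defines csubspace = complex_vector.subspace
    and cspan = complex_vector.span
  by unfold_locales
    (simp_all add: scaleC_add_right scaleC_add_left scaleC_scaleC scaleC_one)

lemma norm_scaleC: "norm (c *\<^sub>C x) = cmod c * norm (x :: 'a::complex_inner)"
proof -
  have "cinner x (c *\<^sub>C x) = cnj c * cinner x x"
    by (subst (1 2) cinner_commute) (simp add: cinner_scaleC_left)
  then have "cinner (c *\<^sub>C x) (c *\<^sub>C x) = (c * cnj c) * cinner x x"
    by (simp add: cinner_scaleC_left)
  also have "\<dots> = of_real ((cmod c)\<^sup>2) * cinner x x"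
    by (simp only: complex_norm_square)
  finally show ?thesis
    by (simp add: norm_eq_sqrt_cinner[where 'a = 'a] real_sqrt_mult)
qed

section \<open>Bounded and compact operators\<close>

text \<open>The algebra \<open>B(H)\<close> is the set of those elements of the library's type of bounded real-linear
  maps which are complex-linear.  It inherits the operator norm of that type, and it is closed
  in it, so that closures of subsets of \<open>B(H)\<close> may be taken in the ambient type.\<close>

definition bounded_ops :: "('a::complex_inner \<Rightarrow>\<^sub>L 'a) set" where
  "bounded_ops = {T. Vector_Spaces.linear scaleC scaleC (blinfun_apply T)}"

definition compact_ops :: "('a::complex_inner \<Rightarrow>\<^sub>L 'a) set" where
  "compact_ops = {T \<in> bounded_ops. compact (closure (blinfun_apply T ` cball 0 1))}"

lift_definition scalar_op :: "complex \<Rightarrow> ('a::complex_inner \<Rightarrow>\<^sub>L 'a)" is "\<lambda>c x. c *\<^sub>C x"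
proof -
  fix c :: complex
  show "bounded_linear (\<lambda>x::'a. c *\<^sub>C x)"
    by (rule bounded_linear_intro[where K = "cmod c"])
      (simp_all add: scaleC_add_right scaleR_scaleC scaleC_scaleC mult.commute norm_scaleC)
qed

lemma bounded_ops_iff:
  "T \<in> bounded_ops \<longleftrightarrow> (\<forall>c x. blinfun_apply T (c *\<^sub>C x) = c *\<^sub>C blinfun_apply T x)"
  unfolding bounded_ops_def Vector_Spaces.linear_iff
  by (simp add: blinfun.add_right complex_vector.vector_space_axioms)

lemma closed_bounded_ops: "closed (bounded_ops :: ('a::complex_inner \<Rightarrow>\<^sub>L 'a) set)"
proof -
  have *: "(bounded_ops :: ('a \<Rightarrow>\<^sub>L 'a) set) =
      (\<Inter>c x. {T. blinfun_apply T (c *\<^sub>C x) = blinfun_apply (scalar_op c) (blinfun_apply T x)})"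
    by (auto simp: bounded_ops_iff scalar_op.rep_eq)
  show ?thesis
    unfolding * by (intro closed_INT ballI closed_Collect_eq continuous_intros)
qed

lemma scalar_op_bounded: "scalar_op c \<in> bounded_ops"
  by (simp add: bounded_ops_iff scalar_op.rep_eq scaleC_scaleC mult.commute)

section \<open>The essential spectrum\<close>

definition op_ring :: "('a::complex_inner \<Rightarrow>\<^sub>L 'a) ring" where
  "op_ring = \<lparr>carrier = bounded_ops, monoid.mult = blinfun_compose, one = id_blinfun,
     ring.zero = 0, add = (+)\<rparr>"

lemma ring_op_ring: "ring (op_ring :: ('a::complex_inner \<Rightarrow>\<^sub>L 'a) ring)"
proof (rule ringI)
  show "abelian_group (op_ring :: ('a \<Rightarrow>\<^sub>L 'a) ring)"
  proof (rule abelian_groupI)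
    fix x :: "'a \<Rightarrow>\<^sub>L 'a" assume "x \<in> carrier op_ring"
    then have "- x \<in> carrier op_ring" "- x \<oplus>\<^bsub>op_ring\<^esub> x = \<zero>\<^bsub>op_ring\<^esub>"
      by (auto simp: op_ring_def bounded_ops_iff blinfun.minus_left
          complex_vector.scale_minus_right)
    then show "\<exists>y\<in>carrier op_ring. y \<oplus>\<^bsub>op_ring\<^esub> x = \<zero>\<^bsub>op_ring\<^esub>" by blast
  qed (auto simp: op_ring_def bounded_ops_iff blinfun.add_left scaleC_add_right
      complex_vector.scale_zero_right)
  show "Group.monoid (op_ring :: ('a \<Rightarrow>\<^sub>L 'a) ring)"
    by (rule monoidI) (auto simp: op_ring_def bounded_ops_iff intro: blinfun_eqI)
qed (auto simp: op_ring_def blinfun.add_left blinfun.add_right intro!: blinfun_eqI)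

lemma compact_closure_mono:
  fixes A B :: "'a::metric_space set"
  shows "compact B \<Longrightarrow> A \<subseteq> B \<Longrightarrow> compact (closure A)"
  by (metis closed_Int_compact closed_closure closure_minimal compact_imp_closed inf.absorb1)

lemma ideal_compact_ops: "ideal compact_ops (op_ring :: ('a::complex_inner \<Rightarrow>\<^sub>L 'a) ring)"
proof -
  interpret ring "op_ring :: ('a \<Rightarrow>\<^sub>L 'a) ring" by (rule ring_op_ring)
  have inv: "\<ominus>\<^bsub>op_ring\<^esub> T = - T" if "T \<in> bounded_ops" for T :: "'a \<Rightarrow>\<^sub>L 'a"
    using that by (intro minus_equality)
      (auto simp: op_ring_def bounded_ops_iff blinfun.minus_left complex_vector.scale_minus_right)
  have uminus: "- T \<in> compact_ops" if "T \<in> compact_ops" for T :: "'a \<Rightarrow>\<^sub>L 'a"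
  proof -
    have "compact (uminus ` closure (blinfun_apply T ` cball 0 1))"
      using that by (intro compact_continuous_image continuous_intros) (auto simp: compact_ops_def)
    then have "compact (closure (blinfun_apply (- T) ` cball 0 1))"
      by (rule compact_closure_mono)
        (auto simp: blinfun.minus_left intro!: imageI subsetD[OF closure_subset])
    then show ?thesis
      using that by (auto simp: compact_ops_def bounded_ops_iff blinfun.minus_left
          complex_vector.scale_minus_right)
  qed
  have plus: "S + T \<in> compact_ops" if "S \<in> compact_ops" "T \<in> compact_ops" for S T :: "'a \<Rightarrow>\<^sub>L 'a"
  proof -
    let ?A = "closure (blinfun_apply S ` cball 0 1)" and ?B = "closure (blinfun_apply T ` cball 0 1)"
    have "compact {x + y |x y. x \<in> ?A \<and> y \<in> ?B}"
      using that by (intro compact_sums) (auto simp: compact_ops_def)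
    moreover have "blinfun_apply (S + T) ` cball 0 1 \<subseteq> {x + y |x y. x \<in> ?A \<and> y \<in> ?B}"
    proof
      fix z assume "z \<in> blinfun_apply (S + T) ` cball 0 1"
      then obtain x where "x \<in> cball 0 1" "z = blinfun_apply S x + blinfun_apply T x"
        by (auto simp: blinfun.add_left)
      moreover from this have "blinfun_apply S x \<in> ?A" "blinfun_apply T x \<in> ?B"
        by (auto intro!: subsetD[OF closure_subset])
      ultimately show "z \<in> {x + y |x y. x \<in> ?A \<and> y \<in> ?B}" by blast
    qed
    ultimately have "compact (closure (blinfun_apply (S + T) ` cball 0 1))"
      by (rule compact_closure_mono)
    then show ?thesis
      using that by (auto simp: compact_ops_def bounded_ops_iff blinfun.add_left scaleC_add_right)
  qed
  show ?thesis
  proof (rule idealI)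
    show "subgroup compact_ops (add_monoid (op_ring :: ('a \<Rightarrow>\<^sub>L 'a) ring))"
    proof (rule add.subgroupI)
      have "(0 :: 'a \<Rightarrow>\<^sub>L 'a) \<in> compact_ops"
        by (auto simp: compact_ops_def bounded_ops_iff image_constant_conv
            complex_vector.scale_zero_right)
      then show "(compact_ops :: ('a \<Rightarrow>\<^sub>L 'a) set) \<noteq> {}" by blast
      fix S :: "'a \<Rightarrow>\<^sub>L 'a" assume "S \<in> compact_ops"
      then show "\<ominus>\<^bsub>op_ring\<^esub> S \<in> compact_ops"
        using inv uminus by (auto simp: compact_ops_def)
    qed (use plus in \<open>auto simp: op_ring_def compact_ops_def\<close>)
  next
    fix S T :: "'a \<Rightarrow>\<^sub>L 'a" assume S: "S \<in> compact_ops" and T: "T \<in> carrier op_ring"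
    have "compact (blinfun_apply T ` closure (blinfun_apply S ` cball 0 1))"
      using S by (intro compact_continuous_image continuous_intros) (auto simp: compact_ops_def)
    then have "compact (closure (blinfun_apply (T o\<^sub>L S) ` cball 0 1))"
      by (rule compact_closure_mono)
        (auto intro!: imageI subsetD[OF closure_subset])
    then show "T \<otimes>\<^bsub>op_ring\<^esub> S \<in> compact_ops"
      using S T by (auto simp: compact_ops_def op_ring_def bounded_ops_iff)
    have "compact ((*\<^sub>R) (norm T + 1) ` closure (blinfun_apply S ` cball 0 1))"
      using S by (intro compact_scaling) (auto simp: compact_ops_def)
    moreover have "blinfun_apply (S o\<^sub>L T) ` cball 0 1
        \<subseteq> (*\<^sub>R) (norm T + 1) ` closure (blinfun_apply S ` cball 0 1)"
    proof
      fix z assume "z \<in> blinfun_apply (S o\<^sub>L T) ` cball 0 1"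
      then obtain x where x: "norm x \<le> 1" "z = blinfun_apply S (blinfun_apply T x)" by auto
      define y where "y = (1 / (norm T + 1)) *\<^sub>R blinfun_apply T x"
      have pos: "norm T + 1 > 0" using norm_ge_zero[of T] by linarith
      have "norm (blinfun_apply T x) \<le> norm T * norm x" by (rule norm_blinfun)
      also have "\<dots> \<le> norm T + 1" using x(1) mult_left_le[of "norm x" "norm T"] by simp
      finally have "norm y \<le> 1" using pos by (simp add: y_def)
      then have "blinfun_apply S y \<in> closure (blinfun_apply S ` cball 0 1)"
        by (auto intro!: subsetD[OF closure_subset])
      moreover have "z = (norm T + 1) *\<^sub>R blinfun_apply S y"
        using pos by (simp add: y_def x(2) blinfun.scaleR_right)
      ultimately show "z \<in> (*\<^sub>R) (norm T + 1) ` closure (blinfun_apply S ` cball 0 1)" by blast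
    qed
    ultimately have "compact (closure (blinfun_apply (S o\<^sub>L T) ` cball 0 1))"
      by (rule compact_closure_mono)
    then show "S \<otimes>\<^bsub>op_ring\<^esub> T \<in> compact_ops"
      using S T by (auto simp: compact_ops_def op_ring_def bounded_ops_iff)
  qed (rule ring_op_ring)
qed

definition calkin :: "('a::complex_inner \<Rightarrow>\<^sub>L 'a) set ring" where
  "calkin = op_ring Quot compact_ops"

definition calkin_map :: "('a::complex_inner \<Rightarrow>\<^sub>L 'a) \<Rightarrow> ('a \<Rightarrow>\<^sub>L 'a) set" where
  "calkin_map T = compact_ops +>\<^bsub>op_ring\<^esub> T"

lemma calkin_map_hom: "calkin_map \<in> ring_hom op_ring calkin"
  using ideal.rcos_ring_hom[OF ideal_compact_ops]
  by (simp add: calkin_def calkin_map_def[abs_def])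

text \<open>The complex scalars act on a unital complex algebra through the multiples of its unit, so the
  algebra structure is given by the map \<open>\<iota>\<close> which sends \<open>c\<close> to \<open>c\<close> times the unit.\<close>

definition alg_spectrum :: "('b, 'm) ring_scheme \<Rightarrow> (complex \<Rightarrow> 'b) \<Rightarrow> 'b \<Rightarrow> complex set" where
  "alg_spectrum A \<iota> a = {c. a \<ominus>\<^bsub>A\<^esub> \<iota> c \<notin> Units A}"

definition ess_spectrum :: "('a::complex_inner \<Rightarrow>\<^sub>L 'a) \<Rightarrow> complex set" where
  "ess_spectrum T = alg_spectrum calkin (\<lambda>c. calkin_map (scalar_op c)) (calkin_map T)"

section \<open>Absolutely norm attaining and positive operators\<close>

text \<open>The operator norm of the restriction of \<open>T\<close> to a subspace \<open>M\<close>.\<close>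

definition opnorm_on :: "'a::real_normed_vector set \<Rightarrow> ('a \<Rightarrow>\<^sub>L 'b::real_normed_vector) \<Rightarrow> real" where
  "opnorm_on M T = (SUP x\<in>{x \<in> M. norm x \<le> 1}. norm (blinfun_apply T x))"

lemma opnorm_on_UNIV: "opnorm_on UNIV T = norm T"
proof (rule antisym)
  have le: "norm (blinfun_apply T x) \<le> norm T" if "norm x \<le> 1" for x
    using norm_blinfun[of T x] mult_left_le[OF that norm_ge_zero[of T]] by linarith
  show "opnorm_on UNIV T \<le> norm T"
    unfolding opnorm_on_def by (rule cSUP_least) (use le in \<open>auto intro: exI[of _ 0]\<close>)
  have bdd: "bdd_above ((\<lambda>x. norm (blinfun_apply T x)) ` {x \<in> UNIV. norm x \<le> 1})"
    by (rule bdd_aboveI2[where M = "norm T"]) (use le in auto)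
  show "norm T \<le> opnorm_on UNIV T"
  proof (rule norm_blinfun_bound)
    show "0 \<le> opnorm_on UNIV T"
      unfolding opnorm_on_def by (rule cSUP_upper2[OF bdd, of 0]) auto
    fix x
    show "norm (blinfun_apply T x) \<le> opnorm_on UNIV T * norm x"
    proof (cases "x = 0")
      case False
      have "norm (blinfun_apply T (x /\<^sub>R norm x)) \<le> opnorm_on UNIV T"
        unfolding opnorm_on_def by (rule cSUP_upper[OF _ bdd]) (use False in auto)
      then show ?thesis using False
        by (simp add: blinfun.scaleR_right divide_simps mult.commute)
    qed auto
  qed
qed

definition norm_attaining_on ::
    "'a::real_normed_vector set \<Rightarrow> ('a \<Rightarrow>\<^sub>L 'b::real_normed_vector) \<Rightarrow> bool" where
  "norm_attaining_on M T \<longleftrightarrow> (\<exists>x\<in>M. norm x = 1 \<and> norm (blinfun_apply T x) = opnorm_on M T)"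

definition AN :: "('a::complex_inner \<Rightarrow>\<^sub>L 'a) set" where
  "AN = {T \<in> bounded_ops.
     \<forall>M. csubspace M \<and> closed M \<and> M \<noteq> {0} \<longrightarrow> norm_attaining_on M T}"

definition self_adjoint :: "('a::complex_inner \<Rightarrow>\<^sub>L 'a) \<Rightarrow> bool" where
  "self_adjoint T \<longleftrightarrow> T \<in> bounded_ops \<and>
     (\<forall>x y. cinner (blinfun_apply T x) y = cinner x (blinfun_apply T y))"

definition positive_op :: "('a::complex_inner \<Rightarrow>\<^sub>L 'a) \<Rightarrow> bool" where
  "positive_op T \<longleftrightarrow> self_adjoint T \<and> (\<forall>x. cinner (blinfun_apply T x) x \<in> \<real>\<^sub>\<ge>\<^sub>0)"

definition AN_closure_pos :: "('a::complex_inner \<Rightarrow>\<^sub>L 'a) set" where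
  "AN_closure_pos = {T \<in> closure AN. positive_op T}"

end

theory Submission
  imports Defs
begin

text \<open>For self-adjoint \<open>T\<close>, every point of the essential spectrum is a real \<open>l\<close> that admits, orthogonally
  to any finite set, unit vectors \<open>x\<close> with \<open>T x - l x\<close> arbitrarily small; and one of \<open>r\<close>, \<open>- r\<close> lies in the
  essential spectrum when \<open>r\<close> is the distance from \<open>T\<close> to the compact operators.
  If the essential spectrum is \<open>{l}\<close>, the latter fact applied to \<open>T - l\<close> shows that \<open>T - l\<close> has distance
  \<open>0\<close> to the compact operators, hence is a limit of self-adjoint operators \<open>F\<close> of finite rank, and
  \<open>l + F\<close> is absolutely norm attaining.
  Conversely, two points \<open>0 \<le> l < h\<close> of the essential spectrum give, for every \<open>A\<close> near \<open>T\<close>, an orthonormal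
  sequence with orthogonal images under \<open>A\<close> of strictly increasing norms, and \<open>A\<close> does not attain its
  norm on the closed span of that sequence.\<close>

section \<open>Complex inner products\<close>

lemma cinner_zero_left [simp]: "cinner 0 (x::'a::complex_inner) = 0"
  using cinner_add_left[of 0 0 x] by simp

lemma cinner_zero_right [simp]: "cinner (x::'a::complex_inner) 0 = 0"
  by (subst cinner_commute) simp

lemma cinner_add_right: "cinner (x::'a::complex_inner) (y + z) = cinner x y + cinner x z"
  by (metis cinner_add_left cinner_commute complex_cnj_add)

lemma cinner_scaleC_right: "cinner (x::'a::complex_inner) (c *\<^sub>C y) = cnj c * cinner x y"
  by (metis cinner_scaleC_left cinner_commute complex_cnj_mult)

lemma cinner_minus_left: "cinner (- x) (y::'a::complex_inner) = - cinner x y"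
  by (metis add.right_inverse add_eq_0_iff cinner_add_left cinner_zero_left)

lemma cinner_minus_right: "cinner (x::'a::complex_inner) (- y) = - cinner x y"
  by (metis cinner_minus_left cinner_commute complex_cnj_minus)

lemma cinner_diff_left: "cinner (x - y) (z::'a::complex_inner) = cinner x z - cinner y z"
  using cinner_add_left[of x "- y" z] by (simp add: cinner_minus_left)

lemma cinner_diff_right: "cinner (x::'a::complex_inner) (y - z) = cinner x y - cinner x z"
  using cinner_add_right[of x y "- z"] by (simp add: cinner_minus_right)

lemma cinner_scaleR_left: "cinner (r *\<^sub>R x) (y::'a::complex_inner) = of_real r * cinner x y"
  by (simp add: scaleR_scaleC cinner_scaleC_left)

lemma cinner_scaleR_right: "cinner (x::'a::complex_inner) (r *\<^sub>R y) = of_real r * cinner x y"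
  by (simp add: scaleR_scaleC cinner_scaleC_right)

lemmas cinner_simps = cinner_add_left cinner_add_right cinner_diff_left cinner_diff_right
  cinner_minus_left cinner_minus_right cinner_scaleC_left cinner_scaleC_right
  cinner_scaleR_left cinner_scaleR_right

lemma cinner_eq_0_commute: "cinner x y = 0 \<longleftrightarrow> cinner y (x::'a::complex_inner) = 0"
  by (metis cinner_commute complex_cnj_zero)

lemma cinner_self: "cinner x x = of_real ((norm (x::'a::complex_inner))\<^sup>2)"
proof -
  have "Im (cinner x x) = 0"
    by (metis add_0_iff cinner_commute cnj.simps(2) complex.sel(2) equal_neg_zero)
  then show ?thesis
    by (simp add: complex_eq_iff norm_eq_sqrt_cinner[where 'a='a] cinner_ge_zero)
qed

lemma norm_power2_cinner: "(norm (x::'a::complex_inner))\<^sup>2 = Re (cinner x x)"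
  by (simp add: cinner_self)

lemma norm_add_power2:
  "(norm (x + y::'a::complex_inner))\<^sup>2 = (norm x)\<^sup>2 + 2 * Re (cinner x y) + (norm y)\<^sup>2"
proof -
  have "Re (cinner y x) = Re (cinner x y)"
    by (metis cinner_commute cnj.simps(1))
  then show ?thesis
    by (simp add: norm_power2_cinner cinner_simps)
qed

lemma norm_diff_power2:
  "(norm (x - y::'a::complex_inner))\<^sup>2 = (norm x)\<^sup>2 - 2 * Re (cinner x y) + (norm y)\<^sup>2"
  using norm_add_power2[of x "- y"] by (simp add: cinner_simps)

lemma pythagoras:
  "cinner x y = 0 \<Longrightarrow> (norm (x + y::'a::complex_inner))\<^sup>2 = (norm x)\<^sup>2 + (norm y)\<^sup>2"
  by (simp add: norm_add_power2)

text \<open>\<open>k\<close> is chosen so that the \<open>k\<close>-multiple of \<open>y\<close> is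
  the orthogonal projection of \<open>x\<close> onto the line of \<open>y\<close>; by Pythagoras it
  is no longer than \<open>x\<close>.\<close>

lemma cinner_cauchy_schwarz: "cmod (cinner x (y::'a::complex_inner)) \<le> norm x * norm y"
proof (cases "y = 0")
  case False
  define k where "k = cinner x y / of_real ((norm y)\<^sup>2)"
  have ny: "norm y > 0" using False by simp
  have k: "k * of_real ((norm y)\<^sup>2) = cinner x y"
    using ny by (simp add: k_def)
  have "cinner (x - k *\<^sub>C y) (k *\<^sub>C y) = 0"
    using k by (simp add: cinner_simps cinner_self algebra_simps)
  from pythagoras[OF this] have "(norm (k *\<^sub>C y))\<^sup>2 \<le> (norm x)\<^sup>2"
    by simp
  then have "cmod k * norm y \<le> norm x"
    by (simp add: norm_scaleC)
  then have "cmod k * norm y * norm y \<le> norm x * norm y"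
    by (simp add: mult_right_mono)
  moreover have "cmod (cinner x y) = cmod k * norm y * norm y"
    unfolding k[symmetric] by (simp add: norm_mult power2_eq_square)
  ultimately show ?thesis by simp
qed simp

text \<open>Real bilinearity survives the conjugate-linearity in the second argument, and it opens
  the library rules for continuity and finite sums.\<close>

lemma bounded_bilinear_cinner:
  "bounded_bilinear (cinner :: 'a::complex_inner \<Rightarrow> 'a \<Rightarrow> complex)"
  by standard (auto simp: cinner_simps scaleR_conv_of_real
      intro!: exI[of _ 1] cinner_cauchy_schwarz)

lemmas continuous_on_cinner [continuous_intros] =
  bounded_bilinear.continuous_on[OF bounded_bilinear_cinner]

lemma orthogonal_cspan:
  fixes x :: "'a::complex_inner"
  assumes "\<And>w. w \<in> W \<Longrightarrow> cinner x w = 0" and "v \<in> cspan W"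
  shows "cinner x v = 0"
proof -
  have "complex_vector.subspace {v. cinner x v = 0}"
    by (auto intro!: complex_vector.subspaceI simp: cinner_simps)
  from complex_vector.span_minimal[OF _ this, of W] show ?thesis
    using assms by auto
qed

lemma norm_sum_orthogonal:
  fixes u :: "'i \<Rightarrow> 'a::complex_inner"
  assumes "finite F" and "\<And>i j. i \<in> F \<Longrightarrow> j \<in> F \<Longrightarrow> i \<noteq> j \<Longrightarrow> cinner (u i) (u j) = 0"
  shows "(norm (\<Sum>i\<in>F. c i *\<^sub>C u i))\<^sup>2 = (\<Sum>i\<in>F. (cmod (c i))\<^sup>2 * (norm (u i))\<^sup>2)"
  using assms
proof (induction F)
  case (insert a F)
  have "cinner (c a *\<^sub>C u a) (\<Sum>i\<in>F. c i *\<^sub>C u i) = 0"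
    unfolding bounded_bilinear.sum_right[OF bounded_bilinear_cinner]
    using insert by (intro sum.neutral) (auto simp: cinner_simps)
  then show ?case
    using insert by (simp add: pythagoras norm_scaleC power_mult_distrib)
qed simp

section \<open>Orthogonal projections\<close>

text \<open>The bound has the shape that the parallelogram law yields for a minimizing sequence
  whose \<open>n\<close>-th squared error is below \<open>1 / Suc n\<close>.\<close>

lemma cauchy_of_power2_bound:
  fixes s :: "nat \<Rightarrow> 'a::real_normed_vector"
  assumes "\<And>m n. (norm (s m - s n))\<^sup>2 \<le> C * (1 / Suc m + 1 / Suc n)"
  shows "Cauchy s"
proof (rule CauchyI)
  fix e :: real assume e: "0 < e"
  have "(\<lambda>n. 1 / real (Suc n)) \<longlonglongrightarrow> 0"
    using LIMSEQ_inverse_real_of_nat by (simp add: inverse_eq_divide)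
  from tendsto_mult_left[OF this, of C]
  have "(\<lambda>n. C * (1 / Suc n)) \<longlonglongrightarrow> 0" by simp
  then have "\<forall>\<^sub>F n in sequentially. C * (1 / Suc n) < e\<^sup>2 / 2"
    using e by (intro order_tendstoD) auto
  then obtain N where N: "\<And>n. n \<ge> N \<Longrightarrow> C * (1 / Suc n) < e\<^sup>2 / 2"
    unfolding eventually_sequentially by blast
  show "\<exists>M. \<forall>m\<ge>M. \<forall>n\<ge>M. norm (s m - s n) < e"
  proof (intro exI allI impI)
    fix m n assume "m \<ge> N" "n \<ge> N"
    with N[of m] N[of n] have "C * (1 / Suc m + 1 / Suc n) < e\<^sup>2"
      unfolding distrib_left by linarith
    with assms[of m n] have "(norm (s m - s n))\<^sup>2 < e\<^sup>2" by linarith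
    then show "norm (s m - s n) < e"
      using e by (simp add: power2_less_imp_less)
  qed
qed

text \<open>A minimizing sequence for the distance to \<open>M\<close> is Cauchy by the
  parallelogram law. Its limit is a nearest point, and minimality forces orthogonality.\<close>

theorem orthogonal_projection_exists:
  fixes x :: "'a::chilbert_space"
  assumes M: "csubspace M" "closed M"
  shows "\<exists>m\<in>M. \<forall>y\<in>M. cinner (x - m) y = 0"
proof -
  have M0: "M \<noteq> {}" using complex_vector.subspace_0[OF M(1)] by auto
  define d where "d = infdist x M"
  have d0: "d \<ge> 0" and dle: "\<And>y. y \<in> M \<Longrightarrow> d \<le> norm (x - y)"
    by (auto simp: d_def infdist_nonneg dist_norm[symmetric] intro: infdist_le)
  have dle2: "d\<^sup>2 \<le> (norm (x - y))\<^sup>2" if "y \<in> M" for y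
    using dle[OF that] d0 by (rule power_mono)
  have "\<exists>y\<in>M. (norm (x - y))\<^sup>2 < d\<^sup>2 + 1 / Suc n" for n
  proof -
    have "d < sqrt (d\<^sup>2 + 1 / Suc n)"
      using d0 by (intro real_less_rsqrt) auto
    then obtain y where y: "y \<in> M" "dist x y < sqrt (d\<^sup>2 + 1 / Suc n)"
      using M0 by (auto simp: d_def infdist_def cINF_less_iff)
    then have "(dist x y)\<^sup>2 < (sqrt (d\<^sup>2 + 1 / Suc n))\<^sup>2"
      by (intro power_strict_mono) auto
    then show ?thesis using y by (auto simp: dist_norm)
  qed
  then obtain s where sM: "\<And>n. s n \<in> M"
    and s: "\<And>n. (norm (x - s n))\<^sup>2 < d\<^sup>2 + 1 / Suc n" by metis
  have "Cauchy s"
  proof (rule cauchy_of_power2_bound)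
    fix m n
    let ?a = "x - s m" and ?b = "x - s n"
    \<comment> \<open>The midpoint competes in \<open>M\<close>, so the sum term of the
      parallelogram law is at least \<open>4 * d\<^sup>2\<close>.\<close>
    have "(1/2) *\<^sub>R (s m + s n) \<in> M"
      unfolding scaleR_scaleC using M(1) sM
      by (intro complex_vector.subspace_scale complex_vector.subspace_add)
    from dle2[OF this] have "4 * d\<^sup>2 \<le> 4 * (norm (x - (1/2) *\<^sub>R (s m + s n)))\<^sup>2" by simp
    also have "\<dots> = (norm (2 *\<^sub>R (x - (1/2) *\<^sub>R (s m + s n))))\<^sup>2"
      by (simp add: power_mult_distrib)
    also have "2 *\<^sub>R (x - (1/2) *\<^sub>R (s m + s n)) = ?a + ?b"
      by (simp add: algebra_simps scaleR_2)
    finally have "4 * d\<^sup>2 \<le> (norm (?a + ?b))\<^sup>2" .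
    moreover have "(norm (?a + ?b))\<^sup>2 + (norm (?a - ?b))\<^sup>2 = 2 * (norm ?a)\<^sup>2 + 2 * (norm ?b)\<^sup>2"
      unfolding norm_add_power2[of ?a ?b] norm_diff_power2[of ?a ?b] by simp
    moreover have "norm (?a - ?b) = norm (s m - s n)"
      by (simp add: norm_minus_commute)
    ultimately show "(norm (s m - s n))\<^sup>2 \<le> 2 * (1 / Suc m + 1 / Suc n)"
      using s[of m] s[of n] by auto
  qed
  then obtain m where m: "s \<longlonglongrightarrow> m"
    using Cauchy_convergent convergent_def by blast
  have mM: "m \<in> M"
    using closed_sequentially[OF M(2)] sM m by blast
  have "(norm (x - m))\<^sup>2 \<le> d\<^sup>2 + 0"
  proof (rule LIMSEQ_le)
    show "(\<lambda>n. (norm (x - s n))\<^sup>2) \<longlonglongrightarrow> (norm (x - m))\<^sup>2"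
      by (intro tendsto_intros m)
    show "(\<lambda>n. d\<^sup>2 + 1 / Suc n) \<longlonglongrightarrow> d\<^sup>2 + 0"
      using LIMSEQ_inverse_real_of_nat by (intro tendsto_add tendsto_const) (simp add: inverse_eq_divide)
  qed (use s in \<open>auto intro: less_imp_le\<close>)
  then have min: "(norm (x - m))\<^sup>2 \<le> (norm (x - y))\<^sup>2" if "y \<in> M" for y
    using dle2[OF that] by linarith
  have "cinner (x - m) y = 0" if y: "y \<in> M" for y
  proof (cases "y = 0")
    case False
    \<comment> \<open>If \<open>k\<close> were nonzero, \<open>m + k *\<^sub>C y\<close> would be
      strictly closer to \<open>x\<close> than \<open>m\<close>.\<close>
    define k where "k = cinner (x - m) y / of_real ((norm y)\<^sup>2)"
    have k: "k * of_real ((norm y)\<^sup>2) = cinner (x - m) y"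
      using False by (simp add: k_def)
    have "cinner (x - m - k *\<^sub>C y) (k *\<^sub>C y) = 0"
      using k by (simp add: cinner_simps cinner_self algebra_simps)
    from pythagoras[OF this]
    have "(norm (x - m))\<^sup>2 = (norm (x - (m + k *\<^sub>C y)))\<^sup>2 + (norm (k *\<^sub>C y))\<^sup>2"
      by (simp add: algebra_simps)
    moreover have "m + k *\<^sub>C y \<in> M"
      using M(1) mM y by (intro complex_vector.subspace_add complex_vector.subspace_scale)
    ultimately have "(norm (k *\<^sub>C y))\<^sup>2 \<le> 0"
      using min[of "m + k *\<^sub>C y"] by linarith
    then have "k = 0" using False by (simp add: norm_scaleC)
    with k show ?thesis by simp
  qed simp
  with mM show ?thesis by blast
qed

text \<open>Riesz representation of the functional sending \<open>x\<close> to
  \<open>cinner (A x) y\<close>: its kernel \<open>N\<close> is closed, and a vector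
  \<open>u\<close> orthogonal to \<open>N\<close> with nonzero value represents it after
  scaling.\<close>

lemma adjoint_exists:
  fixes A :: "'a::chilbert_space \<Rightarrow>\<^sub>L 'a"
  assumes A: "A \<in> bounded_ops"
  shows "\<exists>z. \<forall>x. cinner (A x) y = cinner x z"
proof (cases "\<forall>x. cinner (A x) y = 0")
  case False
  then obtain x0 where x0: "cinner (A x0) y \<noteq> 0" by blast
  define N where "N = {x. cinner (A x) y = 0}"
  have AC: "A (c *\<^sub>C x) = c *\<^sub>C A x" for c x using A by (auto simp: bounded_ops_iff)
  have "csubspace N"
    unfolding N_def
    by (auto intro!: complex_vector.subspaceI simp: blinfun.add_right blinfun.zero_right cinner_simps AC)
  moreover have "closed N"
    unfolding N_def by (intro closed_Collect_eq continuous_intros)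
  ultimately obtain q where q: "q \<in> N" "\<And>v. v \<in> N \<Longrightarrow> cinner (x0 - q) v = 0"
    using orthogonal_projection_exists by metis
  define u where "u = x0 - q"
  have fu: "cinner (A u) y \<noteq> 0"
    using x0 q(1) by (simp add: u_def N_def blinfun.diff_right cinner_simps)
  then have u0: "u \<noteq> 0" by auto
  \<comment> \<open>The value of \<open>k\<close> is forced by evaluating the wanted identity at
    \<open>u\<close>.\<close>
  define k where "k = cnj (cinner (A u) y) / of_real ((norm u)\<^sup>2)"
  have "cinner (A x) y = cinner x (k *\<^sub>C u)" for x
  proof -
    define t where "t = cinner (A x) y / cinner (A u) y"
    have "x - t *\<^sub>C u \<in> N"
      using fu by (simp add: N_def t_def blinfun.diff_right AC cinner_simps)
    then have "cinner u (x - t *\<^sub>C u) = 0" using q(2) u_def by auto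
    then have "cinner (x - t *\<^sub>C u) u = 0" using cinner_eq_0_commute by blast
    then have "cinner x u = t * of_real ((norm u)\<^sup>2)"
      by (simp add: cinner_simps cinner_self)
    then show ?thesis
      using u0 fu by (simp add: k_def t_def cinner_simps)
  qed
  then show ?thesis by blast
qed (auto intro: exI[of _ 0])

section \<open>Operators of finite rank and compact operators\<close>

lemma bounded_opsD: "A \<in> bounded_ops \<Longrightarrow> blinfun_apply A (c *\<^sub>C x) = c *\<^sub>C blinfun_apply A x"
  by (auto simp: bounded_ops_iff)

lemma bounded_ops_arith:
  fixes A B :: "'a::complex_inner \<Rightarrow>\<^sub>L 'a"
  shows "0 \<in> (bounded_ops :: ('a \<Rightarrow>\<^sub>L 'a) set)" "id_blinfun \<in> (bounded_ops :: ('a \<Rightarrow>\<^sub>L 'a) set)"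
    and "A \<in> bounded_ops \<Longrightarrow> B \<in> bounded_ops \<Longrightarrow> A + B \<in> bounded_ops"
    and "A \<in> bounded_ops \<Longrightarrow> B \<in> bounded_ops \<Longrightarrow> A - B \<in> bounded_ops"
    and "A \<in> bounded_ops \<Longrightarrow> - A \<in> bounded_ops"
    and "A \<in> bounded_ops \<Longrightarrow> B \<in> bounded_ops \<Longrightarrow> A o\<^sub>L B \<in> bounded_ops"
  by (auto simp: bounded_ops_iff blinfun.add_left blinfun.diff_left blinfun.minus_left
      scaleC_add_right complex_vector.scale_right_diff_distrib)

lemma compact_ops_bounded: "K \<in> compact_ops \<Longrightarrow> K \<in> bounded_ops"
  by (simp add: compact_ops_def)

lemma compact_ops_zero: "0 \<in> compact_ops"
  using additive_subgroup.zero_closed[OF ideal.axioms(1)[OF ideal_compact_ops]]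
  by (simp add: op_ring_def)

lemma compact_ops_add: "J \<in> compact_ops \<Longrightarrow> K \<in> compact_ops \<Longrightarrow> J + K \<in> compact_ops"
  using additive_subgroup.a_closed[OF ideal.axioms(1)[OF ideal_compact_ops]]
  by (simp add: op_ring_def)

lemma compact_ops_compose_left: "K \<in> compact_ops \<Longrightarrow> B \<in> bounded_ops \<Longrightarrow> B o\<^sub>L K \<in> compact_ops"
  using ideal.I_l_closed[OF ideal_compact_ops] by (simp add: op_ring_def)

lemma compact_ops_compose_right: "K \<in> compact_ops \<Longrightarrow> B \<in> bounded_ops \<Longrightarrow> K o\<^sub>L B \<in> compact_ops"
  using ideal.I_r_closed[OF ideal_compact_ops] by (simp add: op_ring_def)

lemma compact_ops_uminus:
  assumes "K \<in> compact_ops" shows "- K \<in> compact_ops"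
proof -
  have "- K = K o\<^sub>L (- id_blinfun)"
    by (rule blinfun_eqI) (simp add: blinfun.minus_left blinfun.minus_right)
  then show ?thesis
    using compact_ops_compose_right[OF assms] by (simp add: bounded_ops_arith)
qed

text \<open>For a unit vector this is the orthogonal projection onto its line. For
  \<open>e = 0\<close> it vanishes, which suits the degenerate step of Gram-Schmidt.\<close>

lift_definition rank_one :: "'a::complex_inner \<Rightarrow> 'a \<Rightarrow>\<^sub>L 'a" is "\<lambda>e x. cinner x e *\<^sub>C e"
proof -
  fix e :: 'a
  show "bounded_linear (\<lambda>x. cinner x e *\<^sub>C e)"
  proof (rule bounded_linear_intro[where K = "norm e * norm e"])
    fix x show "norm (cinner x e *\<^sub>C e) \<le> norm x * (norm e * norm e)"
      using cinner_cauchy_schwarz[of x e] by (simp add: norm_scaleC mult.assoc[symmetric] mult_right_mono)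
  qed (simp_all add: cinner_simps scaleC_add_left scaleR_scaleC scaleC_scaleC)
qed

text \<open>The image of the unit ball lies in the multiples of \<open>e\<close> by a closed disc of
  scalars, which form a continuous image of a compact set.\<close>

lemma rank_one_compact: "rank_one e \<in> compact_ops"
proof -
  have "compact ((\<lambda>c. c *\<^sub>C e) ` cball 0 (norm e))"
  proof (intro compact_continuous_image continuous_onI)
    fix c d :: complex and \<epsilon> :: real assume "0 < \<epsilon>"
    have "dist (c' *\<^sub>C e) (c *\<^sub>C e) \<le> \<epsilon>" if "dist c' c < \<epsilon> / (norm e + 1)" for c'
    proof -
      have "dist (c' *\<^sub>C e) (c *\<^sub>C e) = dist c' c * norm e"
        by (metis complex_vector.scale_left_diff_distrib dist_norm norm_scaleC)
      also have "\<dots> \<le> \<epsilon> / (norm e + 1) * (norm e + 1)"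
        using that \<open>0 < \<epsilon>\<close> by (intro mult_mono) auto
      also have "\<dots> = \<epsilon>" by (simp add: add_nonneg_eq_0_iff)
      finally show ?thesis .
    qed
    then show "\<exists>\<delta>>0. \<forall>c'\<in>cball 0 (norm e). dist c' c < \<delta> \<longrightarrow> dist (c' *\<^sub>C e) (c *\<^sub>C e) \<le> \<epsilon>"
      using \<open>0 < \<epsilon>\<close> by (intro exI[of _ "\<epsilon> / (norm e + 1)"]) (auto simp: add_nonneg_pos)
  qed simp
  moreover have "blinfun_apply (rank_one e) ` cball 0 1 \<subseteq> (\<lambda>c. c *\<^sub>C e) ` cball 0 (norm e)"
  proof (clarsimp simp: rank_one.rep_eq)
    fix x :: 'a assume "norm x \<le> 1"
    then have "cmod (cinner x e) \<le> norm e"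
      using cinner_cauchy_schwarz[of x e] mult_right_mono[of "norm x" 1 "norm e"] by simp
    then show "cinner x e *\<^sub>C e \<in> (\<lambda>c. c *\<^sub>C e) ` cball 0 (norm e)" by auto
  qed
  ultimately show ?thesis
    by (auto simp: compact_ops_def bounded_ops_iff rank_one.rep_eq cinner_simps scaleC_scaleC
        intro: compact_closure_mono)
qed

lemma self_adjointD:
  "self_adjoint T \<Longrightarrow> cinner (blinfun_apply T x) y = cinner x (blinfun_apply T y)"
  "self_adjoint T \<Longrightarrow> T \<in> bounded_ops"
  by (auto simp: self_adjoint_def)

text \<open>The orthogonal projection onto \<open>cspan W\<close>: mapping into the span and fixing
  it makes \<open>P\<close> idempotent, self-adjointness makes it orthogonal. Compactness is carried
  along for the work modulo compact operators.\<close>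

definition projection_onto :: "'a::complex_inner set \<Rightarrow> ('a \<Rightarrow>\<^sub>L 'a) \<Rightarrow> bool" where
  "projection_onto W P \<longleftrightarrow> self_adjoint P \<and> P \<in> compact_ops \<and>
     (\<forall>x. blinfun_apply P x \<in> cspan W) \<and> (\<forall>x\<in>cspan W. blinfun_apply P x = x)"

lemma projection_ontoD:
  assumes "projection_onto W P"
  shows "self_adjoint P" "P \<in> compact_ops" "blinfun_apply P x \<in> cspan W"
    "x \<in> cspan W \<Longrightarrow> blinfun_apply P x = x"
  using assms by (auto simp: projection_onto_def)

text \<open>Gram-Schmidt, one generator at a time: the rank-one projection along the part of
  \<open>w\<close> orthogonal to the previous span is added.\<close>

lemma projection_onto_exists:
  fixes W :: "'a::complex_inner set"
  assumes "finite W"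
  obtains P :: "'a \<Rightarrow>\<^sub>L 'a" where "projection_onto W P"
proof -
  have "\<exists>P :: 'a \<Rightarrow>\<^sub>L 'a. projection_onto W P"
    using assms
  proof (induction W)
    case empty
    show ?case
      by (intro exI[of _ 0]) (auto simp: projection_onto_def self_adjoint_def bounded_ops_arith compact_ops_zero)
  next
    case (insert w W)
    then obtain P :: "'a \<Rightarrow>\<^sub>L 'a" where "projection_onto W P" by blast
    note P = projection_ontoD[OF this]
    define u where "u = w - P w"
    \<comment> \<open>If \<open>w\<close> already lies in the span, then \<open>u = 0\<close>, and
      \<open>1 / 0 = 0\<close> gives \<open>e = 0\<close>, so that \<open>Q\<close> equals
      \<open>P\<close>.\<close>
    define e where "e = (1 / norm u) *\<^sub>R u"
    define Q where "Q = P + rank_one e"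
    have sub: "cspan W \<subseteq> cspan (insert w W)"
      by (intro complex_vector.span_mono) auto
    have uW: "cinner v u = 0" if "v \<in> cspan W" for v
      using self_adjointD(1)[OF P(1), of v w] P(4)[OF that] by (simp add: u_def cinner_simps)
    have eW: "cinner v e = 0" if "v \<in> cspan W" for v
      using uW[OF that] by (simp add: e_def cinner_simps)
    have Qsa: "self_adjoint Q"
    proof -
      have "cinner (Q x) y = cinner x (Q y)" for x y
        using self_adjointD(1)[OF P(1), of x y] cinner_commute[of y e]
        by (simp add: Q_def blinfun.add_left rank_one.rep_eq cinner_simps)
      moreover have "Q \<in> bounded_ops"
        using P(2) rank_one_compact by (auto simp: Q_def intro: bounded_ops_arith compact_ops_bounded)
      ultimately show ?thesis by (simp add: self_adjoint_def)
    qed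
    have "e \<in> cspan (insert w W)"
      unfolding e_def u_def scaleR_scaleC
      using sub P(3) by (intro complex_vector.span_scale complex_vector.span_diff)
        (auto intro: complex_vector.span_base)
    then have Qin: "Q x \<in> cspan (insert w W)" for x
      using sub P(3) by (auto simp: Q_def blinfun.add_left rank_one.rep_eq
          intro!: complex_vector.span_add complex_vector.span_scale)
    have "complex_vector.subspace {x. Q x = x}"
      using self_adjointD(2)[OF Qsa]
      by (auto intro!: complex_vector.subspaceI simp: blinfun.add_right bounded_opsD blinfun.zero_right)
    moreover have "Q w = w"
    proof (cases "u = 0")
      case False
      have "cinner w u = cinner u u"
        using uW[OF P(3)[of w]] by (simp add: u_def cinner_diff_left)
      then have "cinner w e *\<^sub>C e = u"
        using False by (simp add: e_def scaleR_scaleC cinner_simps cinner_self scaleC_scaleC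
            power2_eq_square scaleC_one)
      then show ?thesis by (simp add: Q_def blinfun.add_left rank_one.rep_eq u_def)
    qed (simp add: Q_def blinfun.add_left rank_one.rep_eq e_def u_def)
    moreover have "Q x = x" if "x \<in> W" for x
      using P(4)[of x] eW[of x] that
      by (simp add: Q_def blinfun.add_left rank_one.rep_eq complex_vector.span_base)
    ultimately have "cspan (insert w W) \<subseteq> {x. Q x = x}"
      by (intro complex_vector.span_minimal) auto
    moreover have "Q \<in> compact_ops"
      using P(2) rank_one_compact by (auto simp: Q_def intro: compact_ops_add)
    ultimately have "projection_onto (insert w W) Q"
      using Qsa Qin by (auto simp: projection_onto_def)
    then show ?case by blast
  qed
  then show ?thesis using that by blast
qed

lemma projection_orthogonal:
  assumes "projection_onto W P" "w \<in> cspan W"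
  shows "cinner (x - blinfun_apply P x) w = 0"
  using self_adjointD(1)[OF projection_ontoD(1)[OF assms(1)], of x w]
    projection_ontoD(4)[OF assms] by (simp add: cinner_simps)

lemma projection_pythagoras:
  assumes "projection_onto W P"
  shows "(norm x)\<^sup>2 = (norm (blinfun_apply P x))\<^sup>2 + (norm (x - blinfun_apply P x))\<^sup>2"
  using pythagoras[of "x - blinfun_apply P x" "blinfun_apply P x"]
    projection_orthogonal[OF assms projection_ontoD(3)[OF assms], of x x] by simp

lemma projection_norm_le:
  assumes "projection_onto W P"
  shows "norm (blinfun_apply P x) \<le> norm x" "norm (x - blinfun_apply P x) \<le> norm x"
  by (rule power2_le_imp_le[OF _ norm_ge_zero], simp add: projection_pythagoras[OF assms, of x])+

text \<open>The sphere is closed and fixed by \<open>P\<close>, so it sits inside the compact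
  closure of the image of the unit ball under \<open>P\<close>.\<close>

lemma compact_cspan_sphere:
  fixes W :: "'a::complex_inner set"
  assumes "finite W"
  shows "compact {x \<in> cspan W. norm x = 1}"
proof -
  obtain P :: "'a \<Rightarrow>\<^sub>L 'a" where PW: "projection_onto W P"
    by (rule projection_onto_exists[OF assms])
  note P = projection_ontoD[OF PW]
  have eq: "{x \<in> cspan W. norm x = 1} = {x. P x = x} \<inter> {x. norm x = 1}"
  proof (intro Set.set_eqI iffI)
    fix x assume "x \<in> {x. P x = x} \<inter> {x. norm x = 1}"
    then have "P x = x" "norm x = 1" by auto
    then show "x \<in> {x \<in> cspan W. norm x = 1}" using P(3)[of x] by simp
  qed (use P(4) in auto)
  have "closed {x \<in> cspan W. norm x = 1}"
    unfolding eq by (intro closed_Int closed_Collect_eq continuous_intros)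
  moreover have "{x \<in> cspan W. norm x = 1} \<subseteq> closure (P ` cball 0 1)"
  proof
    fix x assume "x \<in> {x \<in> cspan W. norm x = 1}"
    then have "x = P x" "x \<in> cball 0 1" using P(4) by auto
    then have "x \<in> P ` cball 0 1" by blast
    then show "x \<in> closure (P ` cball 0 1)" by (rule subsetD[OF closure_subset])
  qed
  moreover have "compact (closure (P ` cball 0 1))"
    using P(2) by (simp add: compact_ops_def)
  ultimately show ?thesis
    using closed_Int_compact[of "{x \<in> cspan W. norm x = 1}" "closure (P ` cball 0 1)"]
    by (simp add: Int_absorb2)
qed

lemma orthogonal_unit_vector_exists:
  assumes infinite_dim: "\<nexists>B :: 'a::complex_inner set. finite B \<and> cspan B = UNIV"
    and W: "finite (W :: 'a set)"
  shows "\<exists>x. norm x = 1 \<and> (\<forall>w\<in>W. cinner x w = 0)"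
proof -
  obtain P :: "'a \<Rightarrow>\<^sub>L 'a" where PW: "projection_onto W P"
    by (rule projection_onto_exists[OF W])
  note P = projection_ontoD[OF PW]
  obtain x where "x \<notin> cspan W" using infinite_dim W by blast
  then have "x - P x \<noteq> 0" using P(3)[of x] by auto
  then show ?thesis
    using projection_orthogonal[OF PW, of _ x]
    by (intro exI[of _ "(1 / norm (x - P x)) *\<^sub>R (x - P x)"])
      (auto simp: cinner_scaleR_left complex_vector.span_base)
qed

text \<open>Cover the image of the unit ball by finitely many \<open>e\<close>-balls and let
  \<open>W\<close> consist of the adjoint images of their centres. For a unit vector orthogonal to
  \<open>W\<close>, the image is orthogonal to every centre and yet close to one of them.\<close>

lemma compact_op_small_on_orthogonal:
  fixes K :: "'a::chilbert_space \<Rightarrow>\<^sub>L 'a"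
  assumes K: "K \<in> compact_ops" and e: "e > 0"
  shows "\<exists>W. finite W \<and> (\<forall>x. (\<forall>w\<in>W. cinner x w = 0) \<longrightarrow> norm (K x) \<le> e * norm x)"
proof -
  have "compact (closure (K ` cball 0 1))" using K by (simp add: compact_ops_def)
  then obtain Y where Y: "finite Y" "closure (K ` cball 0 1) \<subseteq> (\<Union>y\<in>Y. ball y e)"
    using compactE_image[of "closure (K ` cball 0 1)" "closure (K ` cball 0 1)" "\<lambda>y. ball y e"] e
    by (metis (no_types, lifting) UN_I centre_in_ball open_ball subsetI)
  obtain adj where adj: "\<And>x y. cinner (K x) y = cinner x (adj y)"
    using adjoint_exists[OF compact_ops_bounded[OF K]] by metis
  show ?thesis
  proof (intro exI[of _ "adj ` Y"] conjI allI impI)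
    fix x assume x: "\<forall>w\<in>adj ` Y. cinner x w = 0"
    define z where "z = (1 / norm x) *\<^sub>R x"
    have "norm (K z) \<le> e"
    proof -
      have "K z \<in> closure (K ` cball 0 1)"
        using closure_subset by (rule subsetD) (auto simp: z_def)
      then obtain y where y: "y \<in> Y" "norm (K z - y) < e"
        using Y(2) by (auto simp: dist_norm norm_minus_commute)
      have "cinner (K z) y = 0"
        using x y(1) by (simp add: adj z_def cinner_simps)
      \<comment> \<open>Subtracting the orthogonal vector \<open>y\<close> leaves the inner product
        with \<open>K z\<close> unchanged, so Cauchy-Schwarz yields a factor below
        \<open>e\<close>.\<close>
      then have "(norm (K z))\<^sup>2 = cmod (cinner (K z) (K z - y))"
        by (simp add: cinner_simps cinner_self norm_power)
      also have "\<dots> \<le> norm (K z) * norm (K z - y)"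
        by (rule cinner_cauchy_schwarz)
      also have "\<dots> \<le> norm (K z) * e"
        using y(2) by (intro mult_left_mono) auto
      finally show ?thesis
        using e by (cases "norm (K z) = 0") (auto simp: power2_eq_square)
    qed
    then show "norm (K x) \<le> e * norm x"
      by (cases "x = 0") (auto simp: z_def blinfun.scaleR_right blinfun.zero_right field_simps)
  qed (use Y in simp)
qed

section \<open>Coercive operators\<close>

text \<open>Coercivity bounds \<open>R\<close> below, so it is injective with closed range, and a
  vector orthogonal to the range is zero by coercivity again. The inverse is bounded with constant
  \<open>1 / c\<close>.\<close>

theorem lax_milgram:
  fixes R :: "'a::chilbert_space \<Rightarrow>\<^sub>L 'a"
  assumes R: "R \<in> bounded_ops" and c: "c > 0"
    and coercive: "\<And>x. c * (norm x)\<^sup>2 \<le> Re (cinner (R x) x)"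
  obtains B where "B \<in> bounded_ops" "B o\<^sub>L R = id_blinfun" "R o\<^sub>L B = id_blinfun"
proof -
  have lower: "c * norm x \<le> norm (R x)" for x
  proof (cases "x = 0")
    case False
    have "c * norm x * norm x \<le> Re (cinner (R x) x)"
      using coercive[of x] by (simp add: power2_eq_square mult.assoc)
    also have "\<dots> \<le> norm (R x) * norm x"
      using cinner_cauchy_schwarz[of "R x" x] complex_Re_le_cmod order_trans by blast
    finally show ?thesis using False by simp
  qed simp
  have "complete (R ` UNIV)"
    by (rule complete_isometric_image[OF c])
      (auto simp: lower complete_UNIV blinfun.bounded_linear_right)
  then have "closed (range R)" by (rule complete_imp_closed)
  moreover have "csubspace (range R)"
  proof (rule complex_vector.subspaceI)
    show "0 \<in> range R" by (metis blinfun.zero_right rangeI)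
  next
    fix x y assume "x \<in> range R" "y \<in> range R"
    then show "x + y \<in> range R" by (auto simp: blinfun.add_right[symmetric])
  next
    fix k x assume "x \<in> range R"
    then show "k *\<^sub>C x \<in> range R" by (auto simp: bounded_opsD[OF R, symmetric])
  qed
  ultimately have surj: "\<exists>x. R x = y" for y
  proof -
    obtain m where m: "m \<in> range R" "\<And>v. v \<in> range R \<Longrightarrow> cinner (y - m) v = 0"
      using orthogonal_projection_exists[of "range R" y] \<open>closed (range R)\<close> \<open>csubspace (range R)\<close>
      by blast
    have "cinner (R (y - m)) (y - m) = 0"
      using m(2)[of "R (y - m)"] cinner_eq_0_commute by blast
    then have "c * (norm (y - m))\<^sup>2 \<le> 0"
      using coercive[of "y - m"] by simp
    then have "y = m" using c by (simp add: mult_le_0_iff)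
    with m(1) show ?thesis by auto
  qed
  then obtain g where g: "\<And>y. R (g y) = y" by metis
  have inj: "x = y" if "R x = R y" for x y
    using lower[of "x - y"] that c by (simp add: blinfun.diff_right mult_le_0_iff)
  have "bounded_linear g"
  proof (rule bounded_linear_intro[where K = "1 / c"])
    show "g (x + y) = g x + g y" "g (r *\<^sub>R x) = r *\<^sub>R g x" for x y r
      by (rule inj, simp add: g blinfun.add_right blinfun.scaleR_right)+
    show "norm (g x) \<le> norm x * (1 / c)" for x
      using lower[of "g x"] c by (simp add: g field_simps)
  qed
  then have ap: "blinfun_apply (Blinfun g) = g" by (simp add: bounded_linear_Blinfun_apply)
  have "Blinfun g \<in> bounded_ops"
    unfolding bounded_ops_iff ap by (intro allI, rule inj) (simp add: g bounded_opsD[OF R])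
  moreover have "Blinfun g o\<^sub>L R = id_blinfun" "R o\<^sub>L Blinfun g = id_blinfun"
    by (rule blinfun_eqI, simp add: ap g inj[OF g])+
  ultimately show ?thesis using that by blast
qed

section \<open>The essential spectrum of a self-adjoint operator\<close>

lemma op_ring_minus:
  fixes A B :: "'a::complex_inner \<Rightarrow>\<^sub>L 'a"
  assumes "A \<in> bounded_ops" "B \<in> bounded_ops"
  shows "A \<ominus>\<^bsub>op_ring\<^esub> B = A - B"
proof -
  interpret ring "op_ring :: ('a \<Rightarrow>\<^sub>L 'a) ring" by (rule ring_op_ring)
  have "\<ominus>\<^bsub>op_ring\<^esub> B = - B"
    using assms by (intro minus_equality) (auto simp: op_ring_def bounded_ops_arith)
  then show ?thesis by (simp add: a_minus_def) (simp add: op_ring_def)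
qed

lemma calkin_map_eq_iff:
  assumes "A \<in> bounded_ops" "B \<in> bounded_ops"
  shows "calkin_map A = calkin_map B \<longleftrightarrow> A - B \<in> compact_ops"
  using ring.quotient_eq_iff_same_a_r_cos[OF ring_op_ring ideal_compact_ops, of A B]
    op_ring_minus[OF assms] assms
  by (simp add: calkin_map_def) (simp add: op_ring_def)

lemma calkin_map_compose:
  assumes "A \<in> bounded_ops" "B \<in> bounded_ops"
  shows "calkin_map (A o\<^sub>L B) = calkin_map A \<otimes>\<^bsub>calkin\<^esub> calkin_map B"
  using ring_hom_mult[OF calkin_map_hom, of A B] assms by (simp add: op_ring_def)

lemma calkin_map_one: "calkin_map id_blinfun = \<one>\<^bsub>calkin\<^esub>"
  using ring_hom_one[OF calkin_map_hom] by (simp add: op_ring_def)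

lemma calkin_map_closed: "A \<in> bounded_ops \<Longrightarrow> calkin_map A \<in> carrier calkin"
  using ring_hom_closed[OF calkin_map_hom, of A] by (simp add: op_ring_def)

lemma calkin_carrierE:
  fixes X :: "('a::complex_inner \<Rightarrow>\<^sub>L 'a) set"
  assumes "X \<in> carrier calkin"
  obtains A :: "'a \<Rightarrow>\<^sub>L 'a" where "A \<in> bounded_ops" "X = calkin_map A"
  using assms by (auto simp: calkin_def FactRing_def A_RCOSETS_def' calkin_map_def op_ring_def)

lemma calkin_ring: "ring (calkin :: ('a::complex_inner \<Rightarrow>\<^sub>L 'a) set ring)"
  unfolding calkin_def by (rule ideal.quotient_is_ring[OF ideal_compact_ops])

text \<open>A representative of the inverse class is a left inverse up to a compact operator, from
  which lower bounds for \<open>A\<close> can be drawn.\<close>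

lemma calkin_unitE:
  assumes A: "A \<in> bounded_ops" and U: "calkin_map A \<in> Units calkin"
  obtains B where "B \<in> bounded_ops" "(B o\<^sub>L A) - id_blinfun \<in> compact_ops"
proof -
  obtain X where X: "X \<in> carrier calkin" "X \<otimes>\<^bsub>calkin\<^esub> calkin_map A = \<one>\<^bsub>calkin\<^esub>"
    using U by (auto simp: Units_def)
  obtain B where B: "B \<in> bounded_ops" "X = calkin_map B"
    using calkin_carrierE[OF X(1)] .
  have "calkin_map (B o\<^sub>L A) = calkin_map id_blinfun"
    using X(2) B A by (simp add: calkin_map_compose calkin_map_one)
  then have "(B o\<^sub>L A) - id_blinfun \<in> compact_ops"
    using A B(1) by (simp add: calkin_map_eq_iff bounded_ops_arith)
  with B(1) show ?thesis using that by blast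
qed

text \<open>The parametrices \<open>B\<close> and \<open>C\<close> may differ: in the quotient ring
  a left and a right inverse of the same element coincide.\<close>

lemma calkin_unitI:
  fixes A B C :: "'a::complex_inner \<Rightarrow>\<^sub>L 'a"
  assumes A: "A \<in> bounded_ops" and B: "B \<in> bounded_ops" and C: "C \<in> bounded_ops"
    and BA: "(B o\<^sub>L A) - id_blinfun \<in> compact_ops" and AC: "(A o\<^sub>L C) - id_blinfun \<in> compact_ops"
  shows "calkin_map A \<in> Units calkin"
proof -
  interpret ring "calkin :: ('a \<Rightarrow>\<^sub>L 'a) set ring" by (rule calkin_ring)
  have 1: "calkin_map B \<otimes>\<^bsub>calkin\<^esub> calkin_map A = \<one>\<^bsub>calkin\<^esub>"
    unfolding calkin_map_compose[OF B A, symmetric] calkin_map_one[symmetric]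
    using A B BA by (simp add: calkin_map_eq_iff bounded_ops_arith)
  have 2: "calkin_map A \<otimes>\<^bsub>calkin\<^esub> calkin_map C = \<one>\<^bsub>calkin\<^esub>"
    unfolding calkin_map_compose[OF A C, symmetric] calkin_map_one[symmetric]
    using A C AC by (simp add: calkin_map_eq_iff bounded_ops_arith)
  have "calkin_map B = calkin_map C"
    using inv_unique[OF 1 2] A B C by (simp add: calkin_map_closed)
  with 1 2 show ?thesis
    using A C by (auto simp: Units_def calkin_map_closed)
qed

lemma ess_spectrum_iff:
  fixes T :: "'a::complex_inner \<Rightarrow>\<^sub>L 'a"
  assumes T: "T \<in> bounded_ops"
  shows "c \<in> ess_spectrum T \<longleftrightarrow> calkin_map (T - scalar_op c) \<notin> Units calkin"
proof -
  interpret ring "calkin :: ('a \<Rightarrow>\<^sub>L 'a) set ring" by (rule calkin_ring)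
  let ?c = "scalar_op c :: 'a \<Rightarrow>\<^sub>L 'a"
  have c: "?c \<in> bounded_ops" by (rule scalar_op_bounded)
  then have D: "T - ?c \<in> bounded_ops" using T by (simp add: bounded_ops_arith)
  have "(T - ?c) \<oplus>\<^bsub>op_ring\<^esub> ?c = T" by (simp add: op_ring_def)
  then have "calkin_map (T - ?c) \<oplus>\<^bsub>calkin\<^esub> calkin_map ?c = calkin_map T"
    using ring_hom_add[OF calkin_map_hom, of "T - ?c" ?c] D c
    by (simp add: op_ring_def)
  then have "calkin_map T \<ominus>\<^bsub>calkin\<^esub> calkin_map ?c = calkin_map (T - ?c)"
    using calkin_map_closed[OF D] calkin_map_closed[OF c]
    by (metis a_minus_def add.inv_closed a_assoc r_neg r_zero)
  then show ?thesis by (simp add: ess_spectrum_def alg_spectrum_def)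
qed

section \<open>Self-adjoint operators and their approximate eigenvectors\<close>

lemma self_adjoint_diff_scalar:
  assumes "self_adjoint T" shows "self_adjoint (T - scalar_op (of_real l))"
  using assms by (auto simp: self_adjoint_def scalar_op.rep_eq blinfun.diff_left cinner_simps
      bounded_ops_arith scalar_op_bounded)

lemma self_adjoint_cinner_real: "self_adjoint T \<Longrightarrow> Im (cinner (blinfun_apply T x) x) = 0"
  by (metis add_0_iff cinner_commute cnj.simps(2) equal_neg_zero self_adjointD(1))

text \<open>As \<open>cinner (T x) x\<close> is real, the quadratic form of
  \<open>T - scalar_op c\<close> has imaginary part \<open>- Im c\<close> times the squared norm.
  Multiplication by \<open>k\<close> turns this into a positive real part, so
  \<open>lax_milgram\<close> applies.\<close>

lemma self_adjoint_minus_nonreal_unit: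
  fixes T :: "'a::chilbert_space \<Rightarrow>\<^sub>L 'a"
  assumes T: "self_adjoint T" and c: "Im c \<noteq> 0"
  shows "calkin_map (T - scalar_op c) \<in> Units calkin"
proof -
  define A where "A = T - scalar_op c"
  define k where "k = \<i> * of_real (Im c)"
  have A: "A \<in> bounded_ops"
    using self_adjointD(2)[OF T] by (simp add: A_def bounded_ops_arith scalar_op_bounded)
  have R: "scalar_op k o\<^sub>L A \<in> bounded_ops"
    using A by (simp add: bounded_ops_arith scalar_op_bounded)
  have "(Im c)\<^sup>2 * (norm x)\<^sup>2 \<le> Re (cinner ((scalar_op k o\<^sub>L A) x) x)" for x
    using self_adjoint_cinner_real[OF T, of x]
    by (simp add: A_def k_def blinfun.diff_left scalar_op.rep_eq cinner_simps cinner_self power2_eq_square)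
  then obtain B where B: "B \<in> bounded_ops" "B o\<^sub>L (scalar_op k o\<^sub>L A) = id_blinfun"
      "(scalar_op k o\<^sub>L A) o\<^sub>L B = id_blinfun"
    using lax_milgram[OF R, of "(Im c)\<^sup>2"] c by auto
  have "(B o\<^sub>L scalar_op k) o\<^sub>L A = id_blinfun"
    using B(2) by (metis blinfun_apply_blinfun_compose blinfun_eqI)
  \<comment> \<open>Complex-linearity of \<open>A\<close> lets the scalar \<open>k\<close> pass to
    its right, which yields the right inverse.\<close>
  moreover have "A o\<^sub>L (scalar_op k o\<^sub>L B) = id_blinfun"
  proof (rule blinfun_eqI)
    fix x
    have "blinfun_apply ((scalar_op k o\<^sub>L A) o\<^sub>L B) x = x" unfolding B(3) by simp
    then show "blinfun_apply (A o\<^sub>L (scalar_op k o\<^sub>L B)) x = blinfun_apply id_blinfun x"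
      using A by (simp add: scalar_op.rep_eq bounded_opsD)
  qed
  ultimately show ?thesis
    unfolding A_def[symmetric]
    using A B(1) by (intro calkin_unitI[of _ "B o\<^sub>L scalar_op k" "scalar_op k o\<^sub>L B"])
      (auto simp: bounded_ops_arith scalar_op_bounded compact_ops_zero)
qed

text \<open>If \<open>S\<close> is bounded below on the orthogonal complement of \<open>W\<close> and \<open>P\<close> is the projection onto
  the span of \<open>W\<close>, then \<open>S\<^sup>2 + P\<close> is coercive, so its inverse provides a parametrix of \<open>S\<close>.\<close>

lemma bounded_below_imp_calkin_unit:
  fixes S :: "'a::chilbert_space \<Rightarrow>\<^sub>L 'a"
  assumes S: "self_adjoint S" and W: "finite W" and e: "e > 0"
    and below: "\<And>x. norm x = 1 \<Longrightarrow> (\<And>w. w \<in> W \<Longrightarrow> cinner x w = 0) \<Longrightarrow> e \<le> norm (S x)"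
  shows "calkin_map S \<in> Units calkin"
proof -
  obtain P :: "'a \<Rightarrow>\<^sub>L 'a" where PW: "projection_onto W P"
    by (rule projection_onto_exists[OF W])
  note P = projection_ontoD[OF PW]
  have Sb: "S \<in> bounded_ops" and Pb: "P \<in> bounded_ops"
    using S P(1) by (auto simp: self_adjoint_def)
  define R where "R = (S o\<^sub>L S) + P"
  define s where "s = norm S"
  \<comment> \<open>Adding \<open>e\<^sup>2 * (norm (P x))\<^sup>2\<close> to fact \<open>1\<close>
    bounds \<open>e\<^sup>2 * (norm x)\<^sup>2\<close> by the two squared norms with coefficients
    \<open>2\<close> and \<open>2 * s\<^sup>2 + e\<^sup>2\<close>; their sum is the
    denominator.\<close>
  define c where "c = e\<^sup>2 / (2 + 2 * s\<^sup>2 + e\<^sup>2)"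
  have pos: "2 + 2 * s\<^sup>2 + e\<^sup>2 > 0" by (simp add: add_pos_nonneg)
  have Rb: "R \<in> bounded_ops"
    using Sb Pb by (simp add: R_def bounded_ops_arith)
  have "c * (norm x)\<^sup>2 \<le> Re (cinner (R x) x)" for x
  proof -
    define y where "y = x - P x"
    have yW: "cinner y w = 0" if "w \<in> W" for w
      using projection_orthogonal[OF PW, of w x] that
      by (simp add: y_def complex_vector.span_base)
    have ey: "e * norm y \<le> norm (S y)"
    proof (cases "y = 0")
      case False
      have "e \<le> norm (S ((1 / norm y) *\<^sub>R y))"
        using False yW by (intro below) (auto simp: cinner_simps)
      then show ?thesis using False by (simp add: blinfun.scaleR_right field_simps)
    qed simp
    have "S y = S x - S (P x)" by (simp add: y_def blinfun.diff_right)
    then have "norm (S y) \<le> norm (S x) + norm (S (P x))" by (metis norm_triangle_ineq4)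
    also have "norm (S (P x)) \<le> s * norm (P x)"
      unfolding s_def by (rule norm_blinfun)
    finally have "e * norm y \<le> norm (S x) + s * norm (P x)" using ey by simp
    then have "(e * norm y)\<^sup>2 \<le> (norm (S x) + s * norm (P x))\<^sup>2"
      using e by (intro power_mono) auto
    also have "\<dots> \<le> 2 * (norm (S x))\<^sup>2 + 2 * (s * norm (P x))\<^sup>2"
      using sum_squares_bound[of "norm (S x)" "s * norm (P x)"] by (simp add: power2_sum)
    finally have 1: "e\<^sup>2 * (norm y)\<^sup>2 \<le> 2 * (norm (S x))\<^sup>2 + 2 * s\<^sup>2 * (norm (P x))\<^sup>2"
      by (simp add: power_mult_distrib)
    have 2: "(norm x)\<^sup>2 = (norm (P x))\<^sup>2 + (norm y)\<^sup>2"
      unfolding y_def by (rule projection_pythagoras[OF PW])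
    have "cinner (P x) x = cinner (P x) (P x)"
      using self_adjointD(1)[OF P(1), of "P x" x] P(4)[OF P(3)] by simp
    then have 3: "Re (cinner (R x) x) = (norm (S x))\<^sup>2 + (norm (P x))\<^sup>2"
      using self_adjointD(1)[OF S, of "S x" x]
      by (simp add: R_def blinfun.add_left cinner_simps norm_power2_cinner)
    have 4: "(2 + 2 * s\<^sup>2 + e\<^sup>2) * ((norm (S x))\<^sup>2 + (norm (P x))\<^sup>2)
        = e\<^sup>2 * (norm (P x))\<^sup>2 + (2 * (norm (S x))\<^sup>2 + 2 * s\<^sup>2 * (norm (P x))\<^sup>2)
          + (2 * (norm (P x))\<^sup>2 + 2 * (s\<^sup>2 * (norm (S x))\<^sup>2) + e\<^sup>2 * (norm (S x))\<^sup>2)"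
      by (simp add: algebra_simps)
    have 5: "0 \<le> 2 * (norm (P x))\<^sup>2 + 2 * (s\<^sup>2 * (norm (S x))\<^sup>2) + e\<^sup>2 * (norm (S x))\<^sup>2"
      by simp
    have "e\<^sup>2 * (norm x)\<^sup>2 \<le> (2 + 2 * s\<^sup>2 + e\<^sup>2) * Re (cinner (R x) x)"
      using 1 5 unfolding 2 3 4 distrib_left[of "e\<^sup>2"] by linarith
    then show ?thesis using pos by (simp add: c_def field_simps)
  qed
  moreover have "c > 0" using e pos by (simp add: c_def)
  ultimately obtain B where B: "B \<in> bounded_ops" "B o\<^sub>L R = id_blinfun" "R o\<^sub>L B = id_blinfun"
    using lax_milgram[OF Rb] by blast
  show ?thesis
  proof (rule calkin_unitI[OF Sb, of "B o\<^sub>L S" "S o\<^sub>L B"])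
    have "(B o\<^sub>L S o\<^sub>L S) - id_blinfun = - (B o\<^sub>L P)"
    proof (rule blinfun_eqI)
      fix x
      have "blinfun_apply (B o\<^sub>L R) x = x" unfolding B(2) by simp
      then show "blinfun_apply ((B o\<^sub>L S o\<^sub>L S) - id_blinfun) x = blinfun_apply (- (B o\<^sub>L P)) x"
        by (simp add: R_def blinfun.add_left blinfun.add_right blinfun.diff_left
            blinfun.minus_left eq_neg_iff_add_eq_0) (simp add: algebra_simps)
    qed
    then show "(B o\<^sub>L S o\<^sub>L S) - id_blinfun \<in> compact_ops"
      using P(2) B(1) by (simp add: compact_ops_uminus compact_ops_compose_left)
    have "(S o\<^sub>L (S o\<^sub>L B)) - id_blinfun = - (P o\<^sub>L B)"
    proof (rule blinfun_eqI)
      fix x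
      have "blinfun_apply (R o\<^sub>L B) x = x" unfolding B(3) by simp
      then show "blinfun_apply ((S o\<^sub>L (S o\<^sub>L B)) - id_blinfun) x = blinfun_apply (- (P o\<^sub>L B)) x"
        by (simp add: R_def blinfun.add_left blinfun.add_right blinfun.diff_left
            blinfun.minus_left eq_neg_iff_add_eq_0) (simp add: algebra_simps)
    qed
    then show "(S o\<^sub>L (S o\<^sub>L B)) - id_blinfun \<in> compact_ops"
      using P(2) B(1) by (simp add: compact_ops_uminus compact_ops_compose_right)
  qed (use B(1) Sb in \<open>auto simp: bounded_ops_arith\<close>)
qed

text \<open>One half of Weyl's criterion: if such vectors failed to exist for some \<open>W\<close>
  and \<open>e\<close>, then \<open>T - l\<close> would be bounded below on the complement of
  \<open>W\<close>, hence invertible modulo compact operators.\<close>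

lemma ess_spectrum_self_adjoint:
  fixes T :: "'a::chilbert_space \<Rightarrow>\<^sub>L 'a"
  assumes T: "self_adjoint T" and c: "c \<in> ess_spectrum T"
  shows "\<exists>l. c = of_real l \<and> (\<forall>W e. finite W \<longrightarrow> e > 0 \<longrightarrow>
    (\<exists>x. norm x = 1 \<and> (\<forall>w\<in>W. cinner x w = 0) \<and> norm (T x - l *\<^sub>R x) < e))"
proof -
  have nu: "calkin_map (T - scalar_op c) \<notin> Units calkin"
    using c ess_spectrum_iff[OF self_adjointD(2)[OF T]] by blast
  with self_adjoint_minus_nonreal_unit[OF T] have "Im c = 0" by blast
  then have cr: "c = of_real (Re c)" by (simp add: complex_eq_iff)
  show ?thesis
  proof (intro exI[of _ "Re c"] conjI allI impI cr, rule ccontr)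
    fix W :: "'a set" and e :: real
    assume W: "finite W" and e: "e > 0"
      and none: "\<nexists>x. norm x = 1 \<and> (\<forall>w\<in>W. cinner x w = 0) \<and> norm (T x - Re c *\<^sub>R x) < e"
    have "calkin_map (T - scalar_op (of_real (Re c))) \<in> Units calkin"
    proof (rule bounded_below_imp_calkin_unit[OF self_adjoint_diff_scalar[OF T] W e])
      fix x assume "norm x = 1" "\<And>w. w \<in> W \<Longrightarrow> cinner x w = 0"
      with none show "e \<le> norm (blinfun_apply (T - scalar_op (of_real (Re c))) x)"
        by (force simp: blinfun.diff_left scalar_op.rep_eq scaleR_scaleC)
    qed
    with nu cr show False by simp
  qed
qed

section \<open>The distance to the compact operators\<close>

text \<open>Otherwise subtracting the compact operator \<open>S o\<^sub>L P\<close> would leave norm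
  at most \<open>r - e\<close>, below the distance \<open>r\<close>.\<close>

lemma essential_norm_almost_attained:
  fixes S :: "'a::complex_inner \<Rightarrow>\<^sub>L 'a"
  assumes infinite_dim: "\<nexists>B :: 'a set. finite B \<and> cspan B = UNIV"
    and S: "S \<in> bounded_ops" and W: "finite W" and e: "e > 0"
  shows "\<exists>x. norm x = 1 \<and> (\<forall>w\<in>W. cinner x w = 0) \<and> infdist S compact_ops - e \<le> norm (S x)"
proof (rule ccontr)
  define r where "r = infdist S compact_ops"
  assume "\<not> ?thesis"
  then have small: "norm (S x) < r - e" if "norm x = 1" "\<And>w. w \<in> W \<Longrightarrow> cinner x w = 0" for x
    using that unfolding r_def by force
  \<comment> \<open>Infinite dimension enters here: some unit vector is orthogonal to
    \<open>W\<close>, so \<open>small\<close> is not vacuous.\<close>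
  have pos: "r - e > 0"
    using orthogonal_unit_vector_exists[OF infinite_dim W] small norm_ge_zero order_le_less_trans
    by metis
  obtain P :: "'a \<Rightarrow>\<^sub>L 'a" where PW: "projection_onto W P"
    by (rule projection_onto_exists[OF W])
  note P = projection_ontoD[OF PW]
  have "norm (S - (S o\<^sub>L P)) \<le> r - e"
  proof (rule norm_blinfun_bound)
    fix x
    define y where "y = x - P x"
    have yW: "cinner y w = 0" if "w \<in> W" for w
      using projection_orthogonal[OF PW, of w x] that
      by (simp add: y_def complex_vector.span_base)
    have "norm (S y) \<le> (r - e) * norm y"
    proof (cases "y = 0")
      case False
      have "norm (S ((1 / norm y) *\<^sub>R y)) < r - e"
        using False yW by (intro small) (auto simp: cinner_simps)
      then show ?thesis using False by (simp add: blinfun.scaleR_right field_simps)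
    qed simp
    also have "\<dots> \<le> (r - e) * norm x"
      using pos projection_norm_le(2)[OF PW, of x] by (simp add: y_def)
    finally show "norm (blinfun_apply (S - (S o\<^sub>L P)) x) \<le> (r - e) * norm x"
      by (simp add: y_def blinfun.diff_left blinfun.diff_right)
  qed (use pos in simp)
  moreover have "r \<le> norm (S - (S o\<^sub>L P))"
    unfolding r_def dist_norm[symmetric]
    using P(2) S by (intro infdist_le compact_ops_compose_left)
  ultimately show False using e by simp
qed

lemma infdist_compact_opsE:
  fixes S :: "'a::complex_inner \<Rightarrow>\<^sub>L 'a"
  assumes "e > 0"
  obtains K where "K \<in> compact_ops" "norm (S - K) < infdist S compact_ops + e"
proof -
  have ne: "(compact_ops :: ('a \<Rightarrow>\<^sub>L 'a) set) \<noteq> {}" using compact_ops_zero by auto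
  then have "\<exists>K\<in>compact_ops. dist S K < infdist S compact_ops + e"
    using assms by (subst cINF_less_iff[symmetric]) (auto simp: infdist_notempty)
  then show ?thesis using that by (auto simp: dist_norm)
qed

text \<open>An almost maximizing vector for the essential norm \<open>r\<close>, chosen orthogonal to the finitely many
  directions in which the relevant compact operators are not small, is almost an eigenvector of
  \<open>T\<^sup>2\<close> for \<open>r\<^sup>2\<close>.\<close>

lemma essential_norm_in_ess_spectrum:
  fixes T :: "'a::chilbert_space \<Rightarrow>\<^sub>L 'a"
  assumes infinite_dim: "\<nexists>B :: 'a set. finite B \<and> cspan B = UNIV"
    and T: "self_adjoint T"
  defines "r \<equiv> infdist T compact_ops"
  shows "of_real r \<in> ess_spectrum T \<or> of_real (- r) \<in> ess_spectrum T"
proof (rule ccontr)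
  have Tb: "T \<in> bounded_ops" using self_adjointD(2)[OF T] .
  have r0: "r \<ge> 0" by (simp add: r_def infdist_nonneg)
  define A1 where "A1 = T - scalar_op (of_real r)"
  define A2 where "A2 = T - scalar_op (of_real (- r))"
  \<comment> \<open>\<open>A\<close> is \<open>T\<close> squared minus \<open>r\<close> squared;
    with neither \<open>r\<close> nor \<open>- r\<close> in the essential spectrum it would be
    invertible modulo compact operators.\<close>
  define A where "A = A1 o\<^sub>L A2"
  assume "\<not> ?thesis"
  then have U: "calkin_map A1 \<in> Units calkin" "calkin_map A2 \<in> Units calkin"
    by (auto simp: ess_spectrum_iff[OF Tb] A1_def A2_def)
  have b: "A1 \<in> bounded_ops" "A2 \<in> bounded_ops"
    using Tb by (auto simp: A1_def A2_def bounded_ops_arith scalar_op_bounded)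
  interpret ring "calkin :: ('a \<Rightarrow>\<^sub>L 'a) set ring" by (rule calkin_ring)
  have "calkin_map A \<in> Units calkin"
    unfolding A_def calkin_map_compose[OF b] using U by blast
  moreover have "A \<in> bounded_ops" using b by (simp add: A_def bounded_ops_arith)
  ultimately obtain B where B: "B \<in> bounded_ops" "(B o\<^sub>L A) - id_blinfun \<in> compact_ops"
    using calkin_unitE by blast
  define K where "K = (B o\<^sub>L A) - id_blinfun"
  have K: "K \<in> compact_ops" using B by (simp add: K_def)
  have Aap: "A x = T (T x) - (r\<^sup>2) *\<^sub>R x" for x
    by (simp add: A_def A1_def A2_def blinfun.diff_left blinfun.diff_right scalar_op.rep_eq
        scaleR_scaleC blinfun.add_right bounded_opsD[OF Tb] scaleC_scaleC scaleC_add_right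
        power2_eq_square)
  \<comment> \<open>\<open>p e\<close> is the upper bound obtained below for the square of
    \<open>2 * norm B * norm (A x)\<close>. It is a polynomial in \<open>e\<close> with
    \<open>p 0 = 0\<close>, so \<open>1 \<le> p e\<close> for all positive \<open>e\<close> is
    absurd.\<close>
  define p where "p e = (2 * norm B)\<^sup>2 *
      (((r + e) * (r + 2 * e) + e)\<^sup>2 - 2 * r\<^sup>2 * (r\<^sup>2 - 2 * r * e) + r\<^sup>2 * r\<^sup>2)" for e
  have "1 \<le> p e" if e: "e > 0" for e
  proof -
    obtain C where C: "C \<in> compact_ops" "norm (T - C) < r + e"
      using infdist_compact_opsE[OF e, of T] unfolding r_def by blast
    have TC: "norm (T v) \<le> (r + e) * norm v + norm (C v)" for v
    proof -
      have "norm (T v) \<le> norm ((T - C) v) + norm (C v)"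
        by (metis blinfun.diff_left diff_add_cancel norm_triangle_ineq)
      moreover have "norm ((T - C) v) \<le> (r + e) * norm v"
        using norm_blinfun[of "T - C" v] C(2) mult_right_mono[of "norm (T - C)" "r + e" "norm v"]
        by simp
      ultimately show ?thesis by simp
    qed
    obtain W1 where W1: "finite W1"
      "\<forall>x. (\<forall>w\<in>W1. cinner x w = 0) \<longrightarrow> norm (C x) \<le> e * norm x"
      using compact_op_small_on_orthogonal[OF C(1) e] by blast
    obtain W2 where W2: "finite W2"
      "\<forall>x. (\<forall>w\<in>W2. cinner x w = 0) \<longrightarrow> norm ((C o\<^sub>L T) x) \<le> e * norm x"
      using compact_op_small_on_orthogonal[OF compact_ops_compose_right[OF C(1) Tb] e] by blast
    obtain W3 where W3: "finite W3"
      "\<forall>x. (\<forall>w\<in>W3. cinner x w = 0) \<longrightarrow> norm (K x) \<le> (1/2) * norm x"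
      using compact_op_small_on_orthogonal[OF K, of "1/2"] by auto
    obtain x where x: "norm x = 1" "\<And>w. w \<in> W1 \<union> W2 \<union> W3 \<Longrightarrow> cinner x w = 0" "r - e \<le> norm (T x)"
      using essential_norm_almost_attained[OF infinite_dim Tb _ e, of "W1 \<union> W2 \<union> W3"] W1(1) W2(1) W3(1)
      unfolding r_def by blast
    have sm: "norm (C x) \<le> e" "norm (C (T x)) \<le> e" "norm (K x) \<le> 1/2"
      using W1(2) W2(2) W3(2) x(1,2) by (metis UnCI mult.right_neutral blinfun_apply_blinfun_compose)+
    have "norm (T x) \<le> r + 2 * e" using TC[of x] sm x(1) by simp
    then have "(r + e) * norm (T x) \<le> (r + e) * (r + 2 * e)"
      using r0 e by (intro mult_left_mono) auto
    then have TT: "norm (T (T x)) \<le> (r + e) * (r + 2 * e) + e"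
      using TC[of "T x"] sm by linarith
    \<comment> \<open>Expanding a square replaces squaring \<open>r - e \<le> norm (T x)\<close>,
      whose left side may be negative.\<close>
    have "r\<^sup>2 - 2 * r * e \<le> (norm (T x))\<^sup>2"
    proof -
      have "r * (r - e) \<le> r * norm (T x)" using x(3) r0 by (rule mult_left_mono)
      moreover have "0 \<le> (norm (T x) - r)\<^sup>2" by simp
      ultimately show ?thesis by (simp add: power2_eq_square algebra_simps)
    qed
    then have "r\<^sup>2 * (r\<^sup>2 - 2 * r * e) \<le> r\<^sup>2 * (norm (T x))\<^sup>2"
      by (intro mult_left_mono) auto
    moreover have "(norm (T (T x)))\<^sup>2 \<le> ((r + e) * (r + 2 * e) + e)\<^sup>2"
      using TT by (intro power_mono) auto
    moreover have "Re (cinner (T (T x)) x) = (norm (T x))\<^sup>2"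
      using self_adjointD(1)[OF T, of "T x" x] by (simp add: norm_power2_cinner)
    then have "(norm (A x))\<^sup>2 = (norm (T (T x)))\<^sup>2 - 2 * r\<^sup>2 * (norm (T x))\<^sup>2 + r\<^sup>2 * r\<^sup>2"
      using x(1) unfolding Aap norm_diff_power2 cinner_scaleR_right
      by (simp add: power2_eq_square flip: of_real_mult)
    ultimately have Ax: "(norm (A x))\<^sup>2
        \<le> ((r + e) * (r + 2 * e) + e)\<^sup>2 - 2 * r\<^sup>2 * (r\<^sup>2 - 2 * r * e) + r\<^sup>2 * r\<^sup>2"
      by linarith
    \<comment> \<open>\<open>B\<close> inverts \<open>A\<close> up to \<open>K\<close>, and
      \<open>K x\<close> has norm at most one half, so \<open>A x\<close> cannot be small.\<close>
    have "B (A x) = x + K x" by (simp add: K_def blinfun.diff_left)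
    then have "norm x \<le> norm (B (A x)) + norm (K x)"
      by (metis add_diff_cancel_right' norm_triangle_ineq4)
    then have "1 \<le> 2 * (norm B * norm (A x))"
      using norm_blinfun[of B "A x"] sm(3) x(1) by linarith
    then have "1\<^sup>2 \<le> (2 * (norm B * norm (A x)))\<^sup>2" by (intro power_mono) auto
    also have "\<dots> = (2 * norm B)\<^sup>2 * (norm (A x))\<^sup>2" by (simp add: power_mult_distrib)
    also have "\<dots> \<le> p e" unfolding p_def using Ax by (intro mult_left_mono) auto
    finally show ?thesis by simp
  qed
  then have "\<forall>\<^sub>F e in at_right 0. 1 \<le> p e"
    by (auto simp: eventually_at_right_less intro: eventually_mono[OF eventually_at_right_less])
  moreover have "(p \<longlongrightarrow> p 0) (at_right 0)"
    unfolding p_def by (intro tendsto_intros)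
  ultimately have "1 \<le> p 0"
    by (intro tendsto_lowerbound) auto
  then show False by (simp add: p_def power2_eq_square)
qed

section \<open>Absolutely norm attaining operators\<close>

lemma bdd_above_blinfun_unit: "bdd_above ((\<lambda>x. norm (blinfun_apply T x)) ` {x \<in> M. norm x \<le> 1})"
proof (rule bdd_aboveI2)
  fix x assume "x \<in> {x \<in> M. norm x \<le> 1}"
  then show "norm (T x) \<le> norm T"
    using norm_blinfun[of T x] mult_left_le[of "norm x" "norm T"] by simp
qed

lemma csubspace_scaleR: "csubspace M \<Longrightarrow> x \<in> M \<Longrightarrow> r *\<^sub>R x \<in> M"
  by (simp add: scaleR_scaleC complex_vector.subspace_scale)

text \<open>On \<open>M\<close> the operator depends on the component in a finite-dimensional subspace of \<open>M\<close> and on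
  the norm of the remaining component only, so a single extra vector \<open>u0\<close> reduces the
  maximization to a finite-dimensional sphere.\<close>

lemma scalar_plus_finite_rank_AN:
  fixes F :: "'a::chilbert_space \<Rightarrow>\<^sub>L 'a"
  assumes F: "self_adjoint F" and W: "finite W"
    and F0: "\<And>x. (\<forall>w\<in>W. cinner x w = 0) \<Longrightarrow> F x = 0"
  shows "scalar_op (of_real l) + F \<in> AN"
proof -
  define A where "A = scalar_op (of_real l) + F"
  have Ax: "A x = l *\<^sub>R x + F x" for x
    by (simp add: A_def blinfun.add_left scalar_op.rep_eq scaleR_scaleC)
  have "norm_attaining_on M A" if M: "csubspace M" "closed M" "M \<noteq> {0}" for M
  proof -
    obtain q where q: "\<And>w. q w \<in> M" "\<And>w y. y \<in> M \<Longrightarrow> cinner (w - q w) y = 0"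
      using orthogonal_projection_exists[OF M(1,2)] by metis
    \<comment> \<open>Projecting \<open>W\<close> into \<open>M\<close> suffices: a vector of
      \<open>M\<close> orthogonal to \<open>E\<close> is orthogonal to \<open>W\<close>, so
      \<open>F\<close> annihilates it.\<close>
    define E where "E = q ` W"
    have E: "finite E" "E \<subseteq> M" using W q(1) by (auto simp: E_def)
    have spanM: "cspan E \<subseteq> M" by (rule complex_vector.span_minimal[OF E(2) M(1)])
    obtain P :: "'a \<Rightarrow>\<^sub>L 'a" where PE: "projection_onto E P"
      by (rule projection_onto_exists[OF E(1)])
    have Fu: "F u = 0" if u: "u \<in> M" "\<forall>w\<in>E. cinner u w = 0" for u
    proof (rule F0, rule ballI)
      fix w assume "w \<in> W"
      then have "cinner u (q w) = 0" using u(2) by (auto simp: E_def)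
      moreover have "cinner u (w - q w) = 0" using q(2)[OF u(1)] cinner_eq_0_commute by blast
      ultimately show "cinner u w = 0" by (simp add: cinner_simps)
    qed
    have split: "(norm (v + u))\<^sup>2 = (norm v)\<^sup>2 + (norm u)\<^sup>2"
        "(norm (A (v + u)))\<^sup>2 = (norm (A v))\<^sup>2 + l\<^sup>2 * (norm u)\<^sup>2"
      if u: "u \<in> M" "\<forall>w\<in>E. cinner u w = 0" and v: "v \<in> cspan E" for u v
    proof -
      have uv: "cinner u v = 0" using orthogonal_cspan[OF _ v, of u] u(2) by blast
      then have vu: "cinner v u = 0" using cinner_eq_0_commute by blast
      then show "(norm (v + u))\<^sup>2 = (norm v)\<^sup>2 + (norm u)\<^sup>2" by (rule pythagoras)
      \<comment> \<open>Self-adjointness moves \<open>F\<close> onto \<open>u\<close>, where it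
        vanishes.\<close>
      have "cinner (A v) (l *\<^sub>R u) = 0"
        using self_adjointD(1)[OF F, of v u] by (simp add: Ax cinner_simps vu Fu[OF u])
      moreover have "A (v + u) = A v + l *\<^sub>R u"
        by (simp add: Ax blinfun.add_right Fu[OF u] scaleR_add_right)
      ultimately show "(norm (A (v + u)))\<^sup>2 = (norm (A v))\<^sup>2 + l\<^sup>2 * (norm u)\<^sup>2"
        by (simp add: pythagoras power_mult_distrib)
    qed
    \<comment> \<open>\<open>u0\<close> is a unit vector of \<open>M\<close> orthogonal to
      \<open>E\<close>, or \<open>0\<close> if only \<open>0\<close> qualifies; the product equation
      covers both cases.\<close>
    have "\<exists>u0\<in>M. (\<forall>w\<in>E. cinner u0 w = 0) \<and>
        (\<forall>u\<in>M. (\<forall>w\<in>E. cinner u w = 0) \<longrightarrow> norm u * norm u0 = norm u)"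
    proof (cases "\<exists>u\<in>M. u \<noteq> 0 \<and> (\<forall>w\<in>E. cinner u w = 0)")
      case True
      then obtain u where "u \<in> M" "u \<noteq> 0" "\<forall>w\<in>E. cinner u w = 0" by blast
      then show ?thesis
        by (intro bexI[of _ "(1 / norm u) *\<^sub>R u"]) (auto simp: cinner_simps csubspace_scaleR[OF M(1)])
    next
      case False
      then show ?thesis
        using complex_vector.subspace_0[OF M(1)] by (intro bexI[of _ 0]) auto
    qed
    then obtain u0 where u0: "u0 \<in> M" "\<forall>w\<in>E. cinner u0 w = 0"
      "\<And>u. u \<in> M \<Longrightarrow> (\<forall>w\<in>E. cinner u w = 0) \<Longrightarrow> norm u * norm u0 = norm u" by blast
    define D where "D = {x \<in> cspan (insert u0 E). norm x = 1}"
    have DM: "D \<subseteq> M"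
      unfolding D_def using complex_vector.span_minimal[of "insert u0 E" M] E(2) u0(1) M(1) by auto
    \<comment> \<open>By \<open>split\<close>, replacing the component \<open>u\<close> of
      \<open>x\<close> by a multiple of \<open>u0\<close> of equal norm changes neither the norm nor
      that of the image.\<close>
    have transfer: "\<exists>x'\<in>D. norm (A x') = norm (A x)" if x: "x \<in> M" "norm x = 1" for x
    proof -
      define v where "v = P x"
      define u where "u = x - v"
      have v: "v \<in> cspan E" using projection_ontoD(3)[OF PE] by (simp add: v_def)
      have u: "u \<in> M" "\<forall>w\<in>E. cinner u w = 0"
        using complex_vector.subspace_diff[OF M(1) x(1), of v] v spanM projection_orthogonal[OF PE]
        by (auto simp: u_def v_def complex_vector.span_base)
      define u' where "u' = norm u *\<^sub>R u0"
      have nu': "norm u' = norm u" using u0(3)[OF u] by (simp add: u'_def)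
      have u': "u' \<in> M" "\<forall>w\<in>E. cinner u' w = 0"
        using csubspace_scaleR[OF M(1) u0(1)] u0(2) by (auto simp: u'_def cinner_simps)
      have "(norm (v + u'))\<^sup>2 = (norm (v + u))\<^sup>2" "(norm (A (v + u')))\<^sup>2 = (norm (A (v + u)))\<^sup>2"
        using split[OF u v] split[OF u' v] by (simp_all add: nu')
      then have "norm (v + u') = norm (v + u)" "norm (A (v + u')) = norm (A (v + u))"
        by (simp_all only: power2_eq_iff_nonneg norm_ge_zero)
      then have "norm (v + u') = 1" "norm (A (v + u')) = norm (A x)"
        using x(2) by (simp_all add: u_def)
      moreover have "v \<in> cspan (insert u0 E)"
        using v complex_vector.span_mono[of E "insert u0 E"] by auto
      then have "v + u' \<in> cspan (insert u0 E)"
        unfolding u'_def scaleR_scaleC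
        by (intro complex_vector.span_add complex_vector.span_scale) (auto intro: complex_vector.span_base)
      ultimately show ?thesis unfolding D_def by blast
    qed
    have normalize: "(1 / norm y) *\<^sub>R y \<in> M" "norm ((1 / norm y) *\<^sub>R y) = 1"
      if "y \<in> M" "y \<noteq> 0" for y
      using csubspace_scaleR[OF M(1) that(1)] that(2) by auto
    obtain y0 where "y0 \<in> M" "y0 \<noteq> 0"
      using M(3) complex_vector.subspace_0[OF M(1)] by blast
    from transfer[OF normalize[OF this]] have "D \<noteq> {}" by blast
    moreover have "compact D"
      unfolding D_def using E(1) by (intro compact_cspan_sphere) simp
    moreover have "continuous_on D (\<lambda>x. norm (A x))" by (intro continuous_intros)
    ultimately obtain x0 where x0: "x0 \<in> D" "\<And>x. x \<in> D \<Longrightarrow> norm (A x) \<le> norm (A x0)"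
      using continuous_attains_sup[of D "\<lambda>x. norm (A x)"] by blast
    have x0M: "x0 \<in> M" "norm x0 = 1" using x0(1) DM by (auto simp: D_def)
    have "opnorm_on M A \<le> norm (A x0)"
      unfolding opnorm_on_def
    proof (rule cSUP_least)
      show "{x \<in> M. norm x \<le> 1} \<noteq> {}" using x0M by auto
      fix y assume y: "y \<in> {x \<in> M. norm x \<le> 1}"
      show "norm (A y) \<le> norm (A x0)"
      proof (cases "y = 0")
        case False
        then have "norm (A ((1 / norm y) *\<^sub>R y)) \<le> norm (A x0)"
          using transfer[OF normalize[of y]] x0(2) y by force
        then have "norm (A y) \<le> norm (A x0) * norm y"
          using False by (simp add: blinfun.scaleR_right field_simps)
        also have "\<dots> \<le> norm (A x0)" using y by (simp add: mult_left_le)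
        finally show ?thesis .
      qed simp
    qed
    moreover have "norm (A x0) \<le> opnorm_on M A"
      unfolding opnorm_on_def using x0M by (intro cSUP_upper bdd_above_blinfun_unit) auto
    ultimately show ?thesis
      unfolding norm_attaining_on_def using x0M by (intro bexI[of _ x0]) auto
  qed
  moreover have "A \<in> bounded_ops"
    unfolding A_def using self_adjointD(2)[OF F] by (simp add: bounded_ops_arith scalar_op_bounded)
  ultimately show ?thesis unfolding A_def[symmetric] AN_def by blast
qed

text \<open>A compact operator near \<open>S\<close> makes \<open>S\<close> small on the complement
  of a finite \<open>W\<close>. By self-adjointness the compression of \<open>S\<close> to the span
  of \<open>W\<close> is then close to \<open>S\<close>, and it has finite rank.\<close>

lemma scalar_plus_compact_in_closure_AN:
  fixes S :: "'a::chilbert_space \<Rightarrow>\<^sub>L 'a"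
  assumes S: "self_adjoint S" and S0: "infdist S compact_ops = 0"
  shows "scalar_op (of_real l) + S \<in> closure AN"
  unfolding closure_approachable
proof (intro allI impI)
  fix e :: real assume e: "e > 0"
  define d where "d = e / 8"
  have d: "d > 0" using e by (simp add: d_def)
  obtain K where K: "K \<in> compact_ops" "norm (S - K) < d"
    using infdist_compact_opsE[OF d, of S] S0 by auto
  obtain W where W: "finite W" "\<forall>x. (\<forall>w\<in>W. cinner x w = 0) \<longrightarrow> norm (K x) \<le> d * norm x"
    using compact_op_small_on_orthogonal[OF K(1) d] by blast
  have SW: "norm (S x) \<le> 2 * d * norm x" if "\<forall>w\<in>W. cinner x w = 0" for x
  proof -
    have "norm (S x) \<le> norm ((S - K) x) + norm (K x)"
      by (metis blinfun.diff_left diff_add_cancel norm_triangle_ineq)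
    also have "norm ((S - K) x) \<le> d * norm x"
      using norm_blinfun[of "S - K" x] K(2) mult_right_mono[of "norm (S - K)" d "norm x"] by simp
    finally show ?thesis using W(2) that by force
  qed
  obtain P :: "'a \<Rightarrow>\<^sub>L 'a" where PW: "projection_onto W P"
    by (rule projection_onto_exists[OF W(1)])
  note P = projection_ontoD[OF PW]
  have orth: "\<forall>w\<in>W. cinner (x - P x) w = 0" for x
    using projection_orthogonal[OF PW] by (simp add: complex_vector.span_base)
  \<comment> \<open>This transposes \<open>SW\<close>: the residue \<open>g\<close> is orthogonal to
    \<open>W\<close>, and self-adjointness writes its squared norm as the inner product of
    \<open>z\<close> with \<open>S g\<close>.\<close>
  have left: "norm (S z - P (S z)) \<le> 2 * d * norm z" for z
  proof (cases "S z - P (S z) = 0")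
    case False
    define g where "g = S z - P (S z)"
    have "cinner (P (S z)) g = 0"
      using projection_orthogonal[OF PW P(3), of "S z" "S z"] cinner_eq_0_commute unfolding g_def by blast
    then have "(norm g)\<^sup>2 = Re (cinner z (S g))"
      using self_adjointD(1)[OF S, of z g]
      by (simp add: norm_power2_cinner) (simp add: g_def cinner_diff_left)
    also have "\<dots> \<le> norm z * norm (S g)"
      using cinner_cauchy_schwarz[of z "S g"] complex_Re_le_cmod order_trans by blast
    also have "\<dots> \<le> norm z * (2 * d * norm g)"
      using SW[of g] orth[of "S z"] by (intro mult_left_mono) (auto simp: g_def)
    finally have "norm g * norm g \<le> (2 * d * norm z) * norm g"
      by (simp add: power2_eq_square mult_ac)
    moreover have "norm g > 0" using False by (simp add: g_def)
    ultimately show ?thesis unfolding g_def[symmetric] by simp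
  qed (use d in simp)
  define F where "F = P o\<^sub>L (S o\<^sub>L P)"
  have "scalar_op (of_real l) + F \<in> AN"
  proof (rule scalar_plus_finite_rank_AN[OF _ W(1)])
    show "self_adjoint F"
      using S P(1) by (auto simp: self_adjoint_def F_def bounded_ops_arith)
    fix x assume "\<forall>w\<in>W. cinner x w = 0"
    then have "cinner x (P x) = 0" using orthogonal_cspan[of W x "P x"] P(3) by blast
    then have "cinner (P x) (P x) = 0"
      using self_adjointD(1)[OF P(1), of x "P x"] P(4)[OF P(3)] by simp
    then show "F x = 0" by (simp add: F_def cinner_eq_zero_iff)
  qed
  moreover have "norm (F - S) \<le> 4 * d"
  proof (rule norm_blinfun_bound)
    fix x
    \<comment> \<open>The first summand is small by \<open>SW\<close>, the second by
      \<open>left\<close>.\<close>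
    have "S x - F x = S (x - P x) + (S (P x) - P (S (P x)))"
      by (simp add: F_def blinfun.diff_right)
    then have "norm (S x - F x) \<le> norm (S (x - P x)) + norm (S (P x) - P (S (P x)))"
      by (metis norm_triangle_ineq)
    also have "\<dots> \<le> 2 * d * norm (x - P x) + 2 * d * norm (P x)"
      using SW[OF orth] left by (intro add_mono) auto
    also have "\<dots> \<le> 2 * d * norm x + 2 * d * norm x"
      using d projection_norm_le[OF PW, of x] by (intro add_mono mult_left_mono) auto
    finally show "norm (blinfun_apply (F - S) x) \<le> 4 * d * norm x"
      by (simp add: blinfun.diff_left norm_minus_commute)
  qed (use d in simp)
  then have "dist (scalar_op (of_real l) + F) (scalar_op (of_real l) + S) < e"
    using e by (simp add: dist_norm d_def)
  ultimately show "\<exists>A\<in>AN. dist A (scalar_op (of_real l) + S) < e" by blast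
qed

section \<open>Operators with two separated scales on the complement of every finite set\<close>

lemma csubspace_closure:
  fixes V :: "'a::complex_inner set"
  assumes V: "csubspace V"
  shows "csubspace (closure V)"
proof (rule complex_vector.subspaceI)
  show "0 \<in> closure V"
    using complex_vector.subspace_0[OF V] closure_subset by blast
next
  fix x y assume "x \<in> closure V" "y \<in> closure V"
  then obtain f g where "\<And>n. f n \<in> V" "f \<longlonglongrightarrow> x" "\<And>n. g n \<in> V" "g \<longlonglongrightarrow> y"
    unfolding closure_sequential by blast
  then show "x + y \<in> closure V"
    unfolding closure_sequential
    by (intro exI[of _ "\<lambda>n. f n + g n"]) (auto intro: tendsto_add complex_vector.subspace_add[OF V])
next
  fix c x assume "x \<in> closure V"
  then obtain f where f: "\<And>n. f n \<in> V" "f \<longlonglongrightarrow> x"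
    unfolding closure_sequential by blast
  have "(\<lambda>n. scalar_op c (f n)) \<longlonglongrightarrow> scalar_op c x"
    using f(2) by (intro tendsto_intros)
  then show "c *\<^sub>C x \<in> closure V"
    unfolding closure_sequential scalar_op.rep_eq using f(1)
    by (intro exI[of _ "\<lambda>n. c *\<^sub>C f n"]) (auto intro: complex_vector.subspace_scale[OF V])
qed

text \<open>With \<open>a\<close> representing the functional sending \<open>y\<close> to
  \<open>cinner (A y) (A x)\<close>, choosing \<open>y\<close> orthogonal to \<open>x\<close> and
  \<open>a\<close> makes the vectors and their images orthogonal. The squared norm of
  \<open>A z\<close> is then affine in \<open>s\<close>, and \<open>s\<close> can be solved
  for.\<close>

lemma intermediate_value_unit_vector:
  fixes A :: "'a::chilbert_space \<Rightarrow>\<^sub>L 'a"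
  assumes A: "A \<in> bounded_ops"
    and lo: "\<And>W. finite W \<Longrightarrow> \<exists>x. norm x = 1 \<and> (\<forall>w\<in>W. cinner x w = 0) \<and> (norm (A x))\<^sup>2 \<le> l"
    and hi: "\<And>W. finite W \<Longrightarrow> \<exists>x. norm x = 1 \<and> (\<forall>w\<in>W. cinner x w = 0) \<and> h \<le> (norm (A x))\<^sup>2"
    and t: "l \<le> t" "t \<le> h" "l < h" and W: "finite W"
  shows "\<exists>z. norm z = 1 \<and> (\<forall>w\<in>W. cinner z w = 0) \<and> (norm (A z))\<^sup>2 = t"
proof -
  obtain x where x: "norm x = 1" "\<forall>w\<in>W. cinner x w = 0" "(norm (A x))\<^sup>2 \<le> l"
    using lo[OF W] by blast
  obtain a where a: "\<And>y. cinner (A y) (A x) = cinner y a"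
    using adjoint_exists[OF A] by metis
  obtain y where y: "norm y = 1" "\<forall>w\<in>insert x (insert a W). cinner y w = 0" "h \<le> (norm (A y))\<^sup>2"
    using hi[of "insert x (insert a W)"] W by blast
  define \<alpha> \<beta> where "\<alpha> = (norm (A x))\<^sup>2" and "\<beta> = (norm (A y))\<^sup>2"
  define s where "s = (t - \<alpha>) / (\<beta> - \<alpha>)"
  have ab: "\<alpha> \<le> t" "t \<le> \<beta>" "\<alpha> < \<beta>" using x(3) y(3) t by (auto simp: \<alpha>_def \<beta>_def)
  have s: "0 \<le> s" "s \<le> 1" using ab by (auto simp: s_def divide_simps)
  have st: "\<alpha> + s * (\<beta> - \<alpha>) = t" using ab by (simp add: s_def)
  define z where "z = sqrt s *\<^sub>R y + sqrt (1 - s) *\<^sub>R x"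
  have "cinner (sqrt s *\<^sub>R y) (sqrt (1 - s) *\<^sub>R x) = 0"
    using y(2) by (simp add: cinner_simps)
  from pythagoras[OF this] have "(norm z)\<^sup>2 = 1"
    using s x(1) y(1) by (simp add: z_def power_mult_distrib)
  then have "norm z = 1" using norm_ge_zero[of z] by (simp add: power2_eq_1_iff)
  moreover have "\<forall>w\<in>W. cinner z w = 0"
    using x(2) y(2) by (simp add: z_def cinner_simps)
  moreover have "(norm (A z))\<^sup>2 = t"
  proof -
    have Az: "A z = sqrt s *\<^sub>R A y + sqrt (1 - s) *\<^sub>R A x"
      by (simp add: z_def blinfun.add_right blinfun.scaleR_right)
    have "cinner (sqrt s *\<^sub>R A y) (sqrt (1 - s) *\<^sub>R A x) = 0"
      using y(2) a[of y] by (simp add: cinner_simps)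
    from pythagoras[OF this] have "(norm (A z))\<^sup>2 = s * \<beta> + (1 - s) * \<alpha>"
      using s by (simp add: Az power_mult_distrib \<alpha>_def \<beta>_def)
    then show ?thesis using st by (simp add: algebra_simps)
  qed
  ultimately show ?thesis by blast
qed

text \<open>An orthonormal sequence \<open>z\<close> with orthogonal images whose norms increase strictly to \<open>sqrt h\<close>
  spans a closed subspace on which the operator does not attain its norm.\<close>

lemma AN_no_two_scales:
  fixes A :: "'a::chilbert_space \<Rightarrow>\<^sub>L 'a"
  assumes A: "A \<in> AN"
    and lo: "\<And>W. finite W \<Longrightarrow> \<exists>x. norm x = 1 \<and> (\<forall>w\<in>W. cinner x w = 0) \<and> (norm (A x))\<^sup>2 \<le> l"
    and hi: "\<And>W. finite W \<Longrightarrow> \<exists>x. norm x = 1 \<and> (\<forall>w\<in>W. cinner x w = 0) \<and> h \<le> (norm (A x))\<^sup>2"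
  shows "h \<le> l"
proof (rule ccontr)
  assume "\<not> h \<le> l"
  then have lh: "l < h" by simp
  have Ab: "A \<in> bounded_ops" using A by (simp add: AN_def)
  \<comment> \<open>These values start at \<open>l\<close> for \<open>n = 0\<close> and increase
    strictly to \<open>h\<close> without reaching it.\<close>
  define t where "t n = h - (h - l) / real (Suc n)" for n
  have th: "t n < h" "l \<le> t n" "t n \<le> h" for n
  proof -
    have "(h - l) / real (Suc n) \<le> (h - l) / 1"
      using lh by (intro divide_left_mono) auto
    moreover have "0 < (h - l) / real (Suc n)" using lh by simp
    ultimately show "t n < h" "l \<le> t n" "t n \<le> h" by (simp_all add: t_def)
  qed
  obtain adj where adj: "\<And>x y. cinner (A x) y = cinner x (adj y)"
    using adjoint_exists[OF Ab] by metis
  have "\<exists>z. \<forall>n. norm (z n) = 1 \<and> (norm (A (z n)))\<^sup>2 = t n \<and>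
      (\<forall>j<n. cinner (z n) (z j) = 0 \<and> cinner (A (z n)) (A (z j)) = 0)"
  proof (rule dependent_wellorder_choice)
    fix n :: nat and f :: "nat \<Rightarrow> 'a"
    \<comment> \<open>Orthogonality to \<open>adj (A (f j))\<close> is exactly orthogonality of the
      images.\<close>
    have "finite (\<Union>j<n. {f j, adj (A (f j))})" by simp
    from intermediate_value_unit_vector[OF Ab lo hi th(2,3) lh this, of n]
    show "\<exists>r. norm r = 1 \<and> (norm (A r))\<^sup>2 = t n \<and>
        (\<forall>j<n. cinner r (f j) = 0 \<and> cinner (A r) (A (f j)) = 0)"
      unfolding adj by fastforce
  qed auto
  then obtain z where z: "\<And>n. norm (z n) = 1" "\<And>n. (norm (A (z n)))\<^sup>2 = t n"
    and z_less: "\<And>n j. j < n \<Longrightarrow> cinner (z n) (z j) = 0 \<and> cinner (A (z n)) (A (z j)) = 0"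
    by blast
  have orth: "cinner (z i) (z j) = 0 \<and> cinner (A (z i)) (A (z j)) = 0" if "i \<noteq> j" for i j
    using that z_less[of i j] z_less[of j i] cinner_eq_0_commute by (metis linorder_neqE_nat)
  define V where "V = cspan (range z)"
  define M where "M = closure V"
  \<comment> \<open>On the span the right side is a sum of nonnegative terms, squared coefficients
    weighted by \<open>h - t i\<close>; the left side is its \<open>m\<close>-th term, or
    zero.\<close>
  have gap: "(h - t m) * (cmod (cinner x (z m)))\<^sup>2 \<le> h * (norm x)\<^sup>2 - (norm (A x))\<^sup>2"
    if "x \<in> V" for x m
  proof -
    have "\<exists>F c. finite F \<and> F \<subseteq> range z \<and> x = (\<Sum>a\<in>F. c a *\<^sub>C a)"
      using that unfolding V_def complex_vector.span_explicit by auto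
    then obtain F c where F: "finite F" "F \<subseteq> range z" "x = (\<Sum>a\<in>F. c a *\<^sub>C a)"
      by blast
    have Ax: "A x = (\<Sum>a\<in>F. c a *\<^sub>C A a)"
      by (simp add: F(3) blinfun.sum_right bounded_opsD[OF Ab])
    have pair: "cinner a b = 0" "cinner (A a) (A b) = 0" if ab: "a \<in> F" "b \<in> F" "a \<noteq> b" for a b
    proof -
      obtain i j where "a = z i" "b = z j" using ab(1,2) F(2) by blast
      then show "cinner a b = 0" "cinner (A a) (A b) = 0" using ab(3) orth[of i j] by auto
    qed
    have "(norm x)\<^sup>2 = (\<Sum>a\<in>F. (cmod (c a))\<^sup>2 * (norm a)\<^sup>2)"
      unfolding F(3) using pair by (intro norm_sum_orthogonal[OF F(1)])
    also have "\<dots> = (\<Sum>a\<in>F. (cmod (c a))\<^sup>2)"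
      using F(2) z(1) by (intro sum.cong) auto
    finally have nx: "(norm x)\<^sup>2 = (\<Sum>a\<in>F. (cmod (c a))\<^sup>2)" .
    have nA: "(norm (A x))\<^sup>2 = (\<Sum>a\<in>F. (cmod (c a))\<^sup>2 * (norm (A a))\<^sup>2)"
      unfolding Ax using pair by (intro norm_sum_orthogonal[OF F(1)])
    have diff: "h * (norm x)\<^sup>2 - (norm (A x))\<^sup>2 = (\<Sum>a\<in>F. (cmod (c a))\<^sup>2 * (h - (norm (A a))\<^sup>2))"
      unfolding nx nA by (simp add: sum_distrib_left sum_subtractf right_diff_distrib mult.commute)
    have nonneg: "0 \<le> (cmod (c a))\<^sup>2 * (h - (norm (A a))\<^sup>2)" if "a \<in> F" for a
      using that F(2) z(2) th(3) by (intro mult_nonneg_nonneg) auto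
    have cin: "cinner x (z m) = (\<Sum>a\<in>F. c a * cinner a (z m))"
      unfolding F(3) bounded_bilinear.sum_left[OF bounded_bilinear_cinner]
      by (simp add: cinner_scaleC_left)
    have zero: "cinner a (z m) = 0" if a: "a \<in> F" "a \<noteq> z m" for a
    proof -
      obtain i where "a = z i" using a(1) F(2) by blast
      then show ?thesis using orth[of i m] a(2) by auto
    qed
    show ?thesis
    proof (cases "z m \<in> F")
      case True
      have "cinner x (z m) = c (z m) * cinner (z m) (z m)"
        unfolding cin using zero by (subst sum.remove[OF F(1) True]) (simp add: sum.neutral)
      then have "cinner x (z m) = c (z m)" by (simp add: cinner_self z(1))
      then have "(h - t m) * (cmod (cinner x (z m)))\<^sup>2
          = (cmod (c (z m)))\<^sup>2 * (h - (norm (A (z m)))\<^sup>2)"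
        by (simp add: z(2))
      also have "\<dots> \<le> h * (norm x)\<^sup>2 - (norm (A x))\<^sup>2"
        unfolding diff using nonneg by (intro member_le_sum[OF True]) (use F(1) in auto)
      finally show ?thesis .
    next
      case False
      then have "cinner x (z m) = 0"
        unfolding cin using zero by (intro sum.neutral) auto
      then show ?thesis unfolding diff using nonneg by (simp add: sum_nonneg)
    qed
  qed
  have gapM: "(h - t m) * (cmod (cinner x (z m)))\<^sup>2 \<le> h * (norm x)\<^sup>2 - (norm (A x))\<^sup>2"
    if "x \<in> M" for x m
  proof -
    let ?C = "{x. (h - t m) * (cmod (cinner x (z m)))\<^sup>2 \<le> h * (norm x)\<^sup>2 - (norm (A x))\<^sup>2}"
    have "closed ?C" by (intro closed_Collect_le continuous_intros)
    moreover have "V \<subseteq> ?C" using gap by blast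
    ultimately have "M \<subseteq> ?C" unfolding M_def by (rule closure_minimal[rotated])
    then show ?thesis using that by blast
  qed
  have zM: "z n \<in> M" for n
    unfolding M_def V_def by (rule subsetD[OF closure_subset]) (simp add: complex_vector.span_base)
  have "csubspace M"
    unfolding M_def V_def by (intro csubspace_closure complex_vector.subspace_span)
  moreover have "closed M" by (simp add: M_def)
  moreover have "M \<noteq> {0}" using zM[of 0] z(1)[of 0] by force
  ultimately have "norm_attaining_on M A" using A by (simp add: AN_def)
  then obtain x where x: "x \<in> M" "norm x = 1" "norm (A x) = opnorm_on M A"
    unfolding norm_attaining_on_def by blast
  have tx: "t n \<le> (norm (A x))\<^sup>2" for n
  proof -
    have "norm (A (z n)) \<le> opnorm_on M A"
      unfolding opnorm_on_def using zM z(1) by (intro cSUP_upper bdd_above_blinfun_unit) auto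
    then show ?thesis unfolding z(2)[symmetric] x(3) by (intro power_mono) auto
  qed
  have "(\<lambda>n. 1 / real (Suc n)) \<longlonglongrightarrow> 0"
    using LIMSEQ_inverse_real_of_nat by (simp add: inverse_eq_divide)
  from tendsto_diff[OF tendsto_const tendsto_mult_left[OF this, of "h - l"], of h]
  have "t \<longlonglongrightarrow> h" by (simp add: t_def[abs_def])
  then have "h \<le> (norm (A x))\<^sup>2"
    by (rule LIMSEQ_le_const2) (use tx in auto)
  \<comment> \<open>Attaining the norm leaves no gap at \<open>x\<close>, so all coefficients of
    \<open>x\<close> along the sequence vanish, and \<open>x\<close>, lying in \<open>M\<close>, is
    orthogonal to itself.\<close>
  then have le0: "(h - t m) * (cmod (cinner x (z m)))\<^sup>2 \<le> 0" for m
    using gapM[OF x(1), of m] x(2) by simp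
  have "cinner x (z m) = 0" for m
    using le0[of m] th(1)[of m] by (auto simp: mult_le_0_iff)
  then have "V \<subseteq> {v. cinner x v = 0}"
    unfolding V_def using orthogonal_cspan[of "range z" x] by blast
  moreover have "closed {v. cinner x v = 0}" by (intro closed_Collect_eq continuous_intros)
  ultimately have "M \<subseteq> {v. cinner x v = 0}" unfolding M_def by (rule closure_minimal)
  then have "cinner x x = 0" using x(1) by blast
  then show False using x(2) by (simp add: cinner_self)
qed

text \<open>Approximate eigenvectors of \<open>T\<close> for \<open>l\<close> and \<open>h\<close>
  remain so for a nearby \<open>A\<close> in \<open>AN\<close>, giving it two separated
  scales.\<close>

lemma ess_spectrum_subsingleton:
  fixes T :: "'a::chilbert_space \<Rightarrow>\<^sub>L 'a"
  assumes T: "positive_op T" and cl: "T \<in> closure AN"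
    and l: "of_real l \<in> ess_spectrum T" and h: "of_real h \<in> ess_spectrum T"
  shows "h \<le> l"
proof (rule ccontr)
  assume "\<not> h \<le> l"
  then have lh: "l < h" by simp
  have sa: "self_adjoint T" using T by (simp add: positive_op_def)
  have approx: "\<exists>x. norm x = 1 \<and> (\<forall>w\<in>W. cinner x w = 0) \<and> norm (T x - k *\<^sub>R x) < e"
    if "of_real k \<in> ess_spectrum T" "finite W" "e > 0" for k W e
    using ess_spectrum_self_adjoint[OF sa that(1)] that(2,3) by auto
  \<comment> \<open>Positivity is essential here: norms of images see only absolute values, so
    \<open>l\<close> must be nonnegative to be told apart from \<open>h\<close>.\<close>
  have "0 \<le> l + e" if e: "e > 0" for e
  proof -
    obtain x where x: "norm x = 1" "norm (T x - l *\<^sub>R x) < e"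
      using approx[OF l finite.emptyI e] by blast
    have "Re (cinner (T x - l *\<^sub>R x) x) \<le> norm (T x - l *\<^sub>R x) * norm x"
      using cinner_cauchy_schwarz complex_Re_le_cmod order_trans by blast
    moreover have "0 \<le> Re (cinner (T x) x)"
      using T by (simp add: positive_op_def complex_nonneg_Reals_iff)
    ultimately show ?thesis
      using x by (simp add: cinner_simps cinner_self)
  qed
  then have l0: "l \<ge> 0" by (rule field_le_epsilon)
  \<comment> \<open>Errors \<open>d\<close> from \<open>A\<close> and \<open>d\<close> from the
    eigenvectors shift each scale by at most \<open>2 * d\<close>, leaving a gap of half of
    \<open>h - l\<close>.\<close>
  define d where "d = (h - l) / 8"
  have d: "d > 0" using lh by (simp add: d_def)
  obtain A where A: "A \<in> AN" "dist A T < d"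
    using cl d unfolding closure_approachable by blast
  have close: "norm (A x - k *\<^sub>R x) \<le> 2 * d" if "norm x = 1" "norm (T x - k *\<^sub>R x) < d" for x k
  proof -
    have "norm ((A - T) x) \<le> d"
      using norm_blinfun[of "A - T" x] A(2) that(1) by (simp add: dist_norm)
    moreover have eq: "A x - k *\<^sub>R x = (A - T) x + (T x - k *\<^sub>R x)"
      by (simp add: blinfun.diff_left)
    ultimately show ?thesis
      unfolding eq using norm_triangle_ineq[of "(A - T) x" "T x - k *\<^sub>R x"] that(2) by linarith
  qed
  have "(h - 2 * d)\<^sup>2 \<le> (l + 2 * d)\<^sup>2"
  proof (rule AN_no_two_scales[OF A(1)])
    fix W :: "'a set" assume W: "finite W"
    obtain x where x: "norm x = 1" "\<forall>w\<in>W. cinner x w = 0" "norm (T x - l *\<^sub>R x) < d"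
      using approx[OF l W d] by blast
    have "norm (A x) \<le> l + 2 * d"
      using norm_triangle_ineq[of "A x - l *\<^sub>R x" "l *\<^sub>R x"] close[OF x(1,3)] x(1) l0 by simp
    with x show "\<exists>x. norm x = 1 \<and> (\<forall>w\<in>W. cinner x w = 0) \<and> (norm (A x))\<^sup>2 \<le> (l + 2 * d)\<^sup>2"
      by (intro exI[of _ x]) (auto intro: power_mono)
    obtain y where y: "norm y = 1" "\<forall>w\<in>W. cinner y w = 0" "norm (T y - h *\<^sub>R y) < d"
      using approx[OF h W d] by blast
    have "h - 2 * d \<le> norm (A y)"
      using norm_triangle_ineq2[of "h *\<^sub>R y" "h *\<^sub>R y - A y"] close[OF y(1,3)] y(1) l0 lh
      by (simp add: norm_minus_commute)
    moreover have "0 \<le> h - 2 * d" using l0 lh by (simp add: d_def)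
    ultimately show "\<exists>x. norm x = 1 \<and> (\<forall>w\<in>W. cinner x w = 0) \<and> (h - 2 * d)\<^sup>2 \<le> (norm (A x))\<^sup>2"
      using y by (intro exI[of _ y]) (auto intro: power_mono)
  qed
  then have "h - 2 * d \<le> l + 2 * d"
    by (rule power2_le_imp_le) (use l0 d in simp)
  then show False using lh by (simp add: d_def field_simps)
qed

text \<open>Both sides test the same operator \<open>T - scalar_op (d + c)\<close>.\<close>

lemma ess_spectrum_diff_scalar:
  fixes T :: "'a::complex_inner \<Rightarrow>\<^sub>L 'a"
  assumes T: "T \<in> bounded_ops"
  shows "d \<in> ess_spectrum (T - scalar_op c) \<longleftrightarrow> d + c \<in> ess_spectrum T"
proof -
  have "T - scalar_op c - scalar_op d = T - scalar_op (d + c)"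
    by (rule blinfun_eqI) (simp add: blinfun.diff_left scalar_op.rep_eq scaleC_add_left)
  moreover have "T - scalar_op c \<in> bounded_ops"
    using T by (simp add: bounded_ops_arith scalar_op_bounded)
  ultimately show ?thesis using T by (metis ess_spectrum_iff)
qed

theorem theorem4p5:
  fixes T :: "'a::chilbert_space \<Rightarrow>\<^sub>L 'a"
  assumes infinite_dim: "\<nexists>B :: 'a set. finite B \<and> cspan B = UNIV"
    and bounded: "T \<in> bounded_ops"
    and positive: "positive_op T"
  shows "T \<in> AN_closure_pos \<longleftrightarrow> is_singleton (ess_spectrum T)"
proof
  have sa: "self_adjoint T" using positive by (simp add: positive_op_def)
  \<comment> \<open>One of the two signs of the essential norm is always a spectral point.\<close>
  have ne: "ess_spectrum T \<noteq> {}"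
    using essential_norm_in_ess_spectrum[OF infinite_dim sa] by blast
  show "is_singleton (ess_spectrum T)" if "T \<in> AN_closure_pos"
  proof (rule is_singletonI'[OF ne])
    fix c d assume c: "c \<in> ess_spectrum T" and d: "d \<in> ess_spectrum T"
    obtain l h where "c = of_real l" "d = of_real h"
      using ess_spectrum_self_adjoint[OF sa c] ess_spectrum_self_adjoint[OF sa d] by blast
    then show "c = d"
      using ess_spectrum_subsingleton[OF positive, of l h] ess_spectrum_subsingleton[OF positive, of h l]
        that c d by (auto simp: AN_closure_pos_def)
  qed
  assume "is_singleton (ess_spectrum T)"
  then obtain c where c: "ess_spectrum T = {c}" by (rule is_singletonE)
  obtain l where l: "c = of_real l"
    using ess_spectrum_self_adjoint[OF sa, of c] c by blast
  define S where "S = T - scalar_op (of_real l)"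
  have S: "self_adjoint S" unfolding S_def by (rule self_adjoint_diff_scalar[OF sa])
  \<comment> \<open>The shift moves the only spectral point to \<open>0\<close>, so the essential
    norm of \<open>S\<close>, being up to sign such a point, is \<open>0\<close>.\<close>
  have "d = 0" if "d \<in> ess_spectrum S" for d
    using that by (simp add: S_def ess_spectrum_diff_scalar[OF bounded] c l)
  then have "infdist S compact_ops = 0"
    using essential_norm_in_ess_spectrum[OF infinite_dim S] by fastforce
  from scalar_plus_compact_in_closure_AN[OF S this, of l] have "T \<in> closure AN"
    by (simp add: S_def)
  then show "T \<in> AN_closure_pos" using positive by (simp add: AN_closure_pos_def)
qed

end
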